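(* Let $A\subset\mathbb A$ be an essential thin annular continuum. Then: (1) if $A$ is not compactly generated, then either (1a) $C_A$ is not compactly generated, or (1b) $C_A$ is compactly generated and $A$ contains an infinite spike; (2) if $A$ is compactly generated, then so is $C_A$.
   Context: $\mathbb A=\mathbb S^1\times\mathbb R$, $\pi:\mathbb R^2\to\mathbb A$ the projection, $T(x,y)=(x+1,y)$. For $B$ bounded above (resp. below), $\mathcal U^+(B)$ (resp. $\mathcal U^-(B)$) is the connected component of the complement unbounded above (resp. below); same notation in $\mathbb R^2$. A continuum $A\subset\mathbb A$ is an essential annular continuum if $\mathbb A\setminus A$ consists of exactly two connected components $\mathcal U^+(A),\mathcal U^-(A)$, unbounded above resp. below; it is a circloid if it contains no other essential annular continuum strictly; thin means empty interior. For thin $A$, $C_A=\overline{\mathcal U^+(A)}\cap\overline{\mathcal U^-(A)}$ is the unique circloid contained in $A$. Write $\hat A=\pi^{-1}(A)$, $C_{\hat A}=\pi^{-1}(C_A)$. $A$ is compactly generated if there is a compact connected $G_0\subset\hat A$ with $\hat A=\bigcup_{n\in\mathbb Z}T^n(G_0)$. For $X\subset\mathbb R^2$, $h(X)=\sup\{x_1-x_2:(x_1,y_1),(x_2,y_2)\in X\}$. The spikes of $A$ are the connected components of $\hat A\setminus C_{\hat A}$; an infinite spike is a spike $S$ with $h(S)=\infty$. *)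

theory Defs
  imports "HOL-Analysis.Analysis"
begin

definition Ann :: "(complex \<times> real) set" where
  "Ann = sphere 0 1 \<times> UNIV"

definition proj :: "real \<times> real \<Rightarrow> complex \<times> real" where
  "proj p = (cis (2 * pi * fst p), snd p)"

definition Tpow :: "int \<Rightarrow> real \<times> real \<Rightarrow> real \<times> real" where
  "Tpow n p = (fst p + of_int n, snd p)"

definition bdd_above_set :: "('a \<times> real) set \<Rightarrow> bool" where
  "bdd_above_set B \<longleftrightarrow> bdd_above (snd ` B)"

definition bdd_below_set :: "('a \<times> real) set \<Rightarrow> bool" where
  "bdd_below_set B \<longleftrightarrow> bdd_below (snd ` B)"

definition Uplus :: "(complex \<times> real) set \<Rightarrow> (complex \<times> real) set" where
  "Uplus B = \<Union>{U \<in> components (Ann - B). \<not> bdd_above_set U}"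

definition Uminus :: "(complex \<times> real) set \<Rightarrow> (complex \<times> real) set" where
  "Uminus B = \<Union>{U \<in> components (Ann - B). \<not> bdd_below_set U}"

definition continuum :: "'a::topological_space set \<Rightarrow> bool" where
  "continuum A \<longleftrightarrow> compact A \<and> connected A \<and> A \<noteq> {}"

definition essential_annular_continuum :: "(complex \<times> real) set \<Rightarrow> bool" where
  "essential_annular_continuum A \<longleftrightarrow> A \<subseteq> Ann \<and> continuum A \<and>
     (\<exists>U V. components (Ann - A) = {U, V} \<and> U \<noteq> V \<and>
        \<not> bdd_above_set U \<and> \<not> bdd_below_set V)"

definition circloid :: "(complex \<times> real) set \<Rightarrow> bool" where
  "circloid A \<longleftrightarrow> essential_annular_continuum A \<and>
     \<not> (\<exists>B. essential_annular_continuum B \<and> B \<subset> A)"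

definition thin :: "(complex \<times> real) set \<Rightarrow> bool" where
  "thin A \<longleftrightarrow> \<not> (\<exists>U. openin (top_of_set Ann) U \<and> U \<noteq> {} \<and> U \<subseteq> A)"

definition circ_part :: "(complex \<times> real) set \<Rightarrow> (complex \<times> real) set" where
  "circ_part A = closure (Uplus A) \<inter> closure (Uminus A)"

definition lift :: "(complex \<times> real) set \<Rightarrow> (real \<times> real) set" where
  "lift A = proj -` A"

definition compactly_generated :: "(complex \<times> real) set \<Rightarrow> bool" where
  "compactly_generated A \<longleftrightarrow>
     (\<exists>G0. compact G0 \<and> connected G0 \<and> G0 \<subseteq> lift A \<and>
        lift A = (\<Union>n::int. Tpow n ` G0))"

definition hwidth :: "(real \<times> real) set \<Rightarrow> ereal" where
  "hwidth X = (SUP pq \<in> X \<times> X. ereal (fst (fst pq) - fst (snd pq)))"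

definition spikes :: "(complex \<times> real) set \<Rightarrow> (real \<times> real) set set" where
  "spikes A = components (lift A - lift (circ_part A))"

definition has_infinite_spike :: "(complex \<times> real) set \<Rightarrow> bool" where
  "has_infinite_spike A \<longleftrightarrow> (\<exists>S \<in> spikes A. hwidth S = \<infinity>)"

end

theory Submission
  imports Defs
begin

text \<open>
  Work in the plane with the lift \<open>X\<close> of \<open>A\<close>, the lifts \<open>P\<close>, \<open>N\<close> of the two complementary
  domains and \<open>C = closure P \<inter> closure N\<close>. Since \<open>A\<close> is thin, \<open>closure P\<close> and \<open>closure N\<close> cover
  the plane.

  If \<open>X\<close> has a compact connected generator, Janiszewski's theorem shows that points of \<open>P\<close> over a
  bounded interval can be joined to the top inside \<open>P\<close> within a bounded vertical strip, and likewise
  for \<open>N\<close>. Unicoherence of the strip, covered by \<open>closure P\<close> and \<open>closure N\<close>, then joins any two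
  points of \<open>C\<close> over the interval inside \<open>C\<close> within the strip, which gives a generator of \<open>C\<close>.

  Conversely, let \<open>C\<close> be generated and all spikes be of finite width, so that every point of
  \<open>X\<close> can be joined to \<open>C\<close> inside \<open>X\<close> within a bounded width. By Baire's theorem this width is
  uniformly bounded on \<open>X \<inter> B\<close> for some ball \<open>B\<close> centred at a point of \<open>X\<close> on a given side of \<open>C\<close>.
  A path in \<open>P\<close> from the top to \<open>B\<close>, the ball \<open>B\<close>, a continuum in \<open>X\<close> from its centre to \<open>C\<close> and
  the part of the other side of \<open>C\<close> in a strip form a post of bounded width that reaches from top to
  bottom. A subcontinuum of \<open>X\<close> disjoint from \<open>C\<close> that travels farther than the width of the post has
  to cross a translate of it, and can do so only at a point that is joined to \<open>C\<close> within the post.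
  Hence the widths are uniformly bounded, and \<open>X\<close> is generated.
\<close>

section \<open>Separation in the plane\<close>

text \<open>\<open>Janiszewski\<close> speaks about the complex plane; the mutually inverse
  continuous maps \<open>h\<close> and \<open>k\<close> carry it over to
  \<open>real \<times> real\<close>.\<close>

lemma Janiszewski_real2:
  fixes a b :: "real \<times> real"
  assumes "compact S" "closed T" "connected (S \<inter> T)"
    and "connected_component (- S) a b" "connected_component (- T) a b"
  shows "connected_component (- (S \<union> T)) a b"
proof -
  define h :: "real \<times> real \<Rightarrow> complex" where "h = (\<lambda>p. Complex (fst p) (snd p))"
  define k :: "complex \<Rightarrow> real \<times> real" where "k = (\<lambda>z. (Re z, Im z))"
  have kh: "k (h p) = p" for p by (simp add: h_def k_def)
  have hk: "h (k z) = z" for z by (simp add: h_def k_def)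
  have inj: "inj h" using kh by (metis injI)
  have him: "h ` S = k -` S" for S
    using kh hk by (auto simp: image_iff) metis
  have conth: "continuous_on S h" for S
    unfolding h_def complex_eq by (intro continuous_intros)
  have contk: "continuous_on S k" for S
    unfolding k_def by (intro continuous_intros)
  have cl: "closed (h ` S)" if "closed S" for S
    unfolding him using closed_vimage[OF that contk] by simp
  have co: "compact (h ` S)" if "compact S" for S
    by (rule compact_continuous_image[OF conth that])
  have cc: "connected_component (- (h ` S)) (h a) (h b)" if cS: "connected_component (- S) a b" for S
  proof -
    obtain W where "connected W" "W \<subseteq> - S" "a \<in> W" "b \<in> W"
      using cS unfolding connected_component_def by blast
    then have "connected (h ` W)" "h ` W \<subseteq> - (h ` S)" "h a \<in> h ` W" "h b \<in> h ` W"
      using connected_continuous_image[OF conth] inj by (auto dest: injD)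
    then show ?thesis unfolding connected_component_def by blast
  qed
  have "connected_component (- (h ` S \<union> h ` T)) (h a) (h b)"
  proof (rule Janiszewski)
    show "connected (h ` S \<inter> h ` T)"
      using connected_continuous_image[OF conth assms(3)] image_Int[OF inj] by metis
  qed (use assms cl co cc in auto)
  then obtain W where W: "connected W" "W \<subseteq> - (h ` S \<union> h ` T)" "h a \<in> W" "h b \<in> W"
    unfolding connected_component_def by blast
  have "connected (k ` W)" by (rule connected_continuous_image[OF contk W(1)])
  moreover have "k ` W \<subseteq> - (S \<union> T)" using W(2) him by auto
  moreover have "a \<in> k ` W" "b \<in> k ` W" using W(3,4) kh by (metis image_eqI)+
  ultimately show ?thesis unfolding connected_component_def by blast
qed

text \<open>A pointwise form of unicoherence. If \<open>y\<close> were in \<open>L\<close>, take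
  disjoint open \<open>U\<close>, \<open>V\<close> around \<open>K\<close> and \<open>L\<close>. The
  rests of \<open>Q\<close> and of \<open>P\<close> outside \<open>U \<union> V\<close> are disjoint
  closed sets, avoided by \<open>P1\<close> and \<open>Q1\<close> respectively, so neither separates
  \<open>x\<close> from \<open>y\<close>. Hence neither does their union, whose complement is
  \<open>U \<union> V\<close>.\<close>

lemma closed_cover_inter_not_separated:
  fixes P Q :: "'a::euclidean_space set"
  assumes cl: "closed P" "closed Q" "P \<union> Q = UNIV"
    and P1: "connected P1" "P1 \<subseteq> P" "x \<in> P1" "y \<in> P1"
    and Q1: "connected Q1" "Q1 \<subseteq> Q" "x \<in> Q1" "y \<in> Q1"
    and K: "closed K" "closed L" "K \<inter> L = {}" "P \<inter> Q = K \<union> L" "x \<in> K"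
  shows "y \<in> K"
proof (rule ccontr)
  assume "y \<notin> K"
  then have "y \<in> L" using P1 Q1 K by blast
  obtain U V where UV: "open U" "open V" "K \<subseteq> U" "L \<subseteq> V" "U \<inter> V = {}"
    using separation_normal[OF K(1-3)] by metis
  have "connected_component (- ((Q - (U \<union> V)) \<union> (P - (U \<union> V)))) x y"
  proof (rule separation_by_Un_closed_pointwise)
    show "closed (Q - (U \<union> V))" "closed (P - (U \<union> V))"
      using cl UV by (auto intro: closed_Diff)
    show "(Q - (U \<union> V)) \<inter> (P - (U \<union> V)) = {}" using K(4) UV by blast
    have "P1 \<subseteq> - (Q - (U \<union> V))" "Q1 \<subseteq> - (P - (U \<union> V))" using P1 Q1 K(4) UV by blast+
    then show "connected_component (- (Q - (U \<union> V))) x y" "connected_component (- (P - (U \<union> V))) x y"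
      unfolding connected_component_def using P1 Q1 by blast+
  qed
  moreover have "- ((Q - (U \<union> V)) \<union> (P - (U \<union> V))) = U \<union> V" using cl(3) by blast
  ultimately obtain W where W: "connected W" "W \<subseteq> U \<union> V" "x \<in> W" "y \<in> W"
    unfolding connected_component_def by metis
  then show False
    using connectedD[OF W(1) UV(1,2)] UV \<open>y \<in> L\<close> K(5) by blast
qed

text \<open>By Sura-Bura a component of a compact set has arbitrarily small clopen neighbourhoods.
  This turns a failure of the component to reach \<open>F\<close> into a splitting of
  \<open>S\<close> into two compact parts.\<close>

lemma compact_component_clopen:
  fixes S :: "'a::euclidean_space set"
  assumes "compact S" "x \<in> S" "closed F" "connected_component_set S x \<inter> F = {}"
  obtains L where "compact L" "compact (S - L)" "x \<in> L" "L \<subseteq> S" "L \<inter> F = {}"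
proof -
  let ?K = "connected_component_set S x"
  have "compact ?K"
    using assms(1) closed_connected_component compact_eq_bounded_closed connected_component_subset
      bounded_subset by metis
  moreover have "?K \<in> components S" using assms(2) by (simp add: componentsI)
  ultimately obtain L where L: "openin (top_of_set S) L" "compact L" "?K \<subseteq> L" "L \<subseteq> - F"
    using Sura_Bura_clopen_subset[OF closed_imp_locally_compact[OF compact_imp_closed[OF assms(1)]], of ?K "- F"]
      assms(3,4) by (metis disjoint_eq_subset_Compl open_Compl)
  have "closedin (top_of_set S) (S - L)" using L(1) by (simp add: closedin_diff)
  then have "compact (S - L)" using assms(1) closedin_compact by blast
  moreover have "x \<in> L" using L(3) assms(2) by auto
  ultimately show ?thesis using that L openin_imp_subset[OF L(1)] by blast
qed

text \<open>Unicoherence of the strip, reduced to that of the plane by a retraction.\<close>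

lemma strip_inter_connected_component:
  fixes P Q :: "(real \<times> real) set"
  assumes cl: "closed P" "closed Q" "P \<union> Q = UNIV"
    and P1: "connected P1" "P1 \<subseteq> P" "x \<in> P1" "y \<in> P1" "P1 \<subseteq> {-R..R} \<times> UNIV"
    and Q1: "connected Q1" "Q1 \<subseteq> Q" "x \<in> Q1" "y \<in> Q1" "Q1 \<subseteq> {-R..R} \<times> UNIV"
    and comp: "compact (P \<inter> Q \<inter> {-R..R} \<times> UNIV)"
  shows "connected_component (P \<inter> Q \<inter> {-R..R} \<times> UNIV) x y"
proof (rule ccontr)
  let ?S = "P \<inter> Q \<inter> {-R..R} \<times> UNIV"
  assume "\<not> connected_component ?S x y"
  then have "connected_component_set ?S x \<inter> {y} = {}" by auto
  moreover have "x \<in> ?S" using P1 Q1 by blast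
  ultimately obtain L where L: "compact L" "compact (?S - L)" "x \<in> L" "L \<subseteq> ?S" "L \<inter> {y} = {}"
    using compact_component_clopen[OF comp, of x "{y}"] by auto
  \<comment> \<open>\<open>c\<close> clamps the first coordinate and so retracts the plane onto the
    strip. A splitting of \<open>P \<inter> Q\<close> over the strip pulls back to a splitting of
    the intersection of the two preimages, which still cover the plane.\<close>
  define c where "c = (\<lambda>p::real \<times> real. (max (-R) (min R (fst p)), snd p))"
  have contc: "continuous_on UNIV c" unfolding c_def by (intro continuous_intros)
  have R0: "-R \<le> R" using P1 by fastforce
  have cid: "c p = p" if "p \<in> {-R..R} \<times> UNIV" for p
    using that by (auto simp: c_def prod_eq_iff)
  have cin: "c p \<in> {-R..R} \<times> UNIV" for p using R0 by (auto simp: c_def)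
  have clv: "closed (c -` F)" if "closed F" for F
    using closed_vimage[OF that contc] .
  have "y \<in> c -` L"
  proof (rule closed_cover_inter_not_separated[of "c -` P" "c -` Q" P1 x y Q1 _ "c -` (?S - L)"])
    show "c -` P \<union> c -` Q = UNIV" using cl(3) by blast
    show "c -` L \<inter> c -` (?S - L) = {}" by blast
    show "P1 \<subseteq> c -` P"
      by (rule subsetI, rule vimageI2) (use cid P1(2,5) in \<open>metis subsetD\<close>)
    show "Q1 \<subseteq> c -` Q"
      by (rule subsetI, rule vimageI2) (use cid Q1(2,5) in \<open>metis subsetD\<close>)
    show "c -` P \<inter> c -` Q = c -` L \<union> c -` (?S - L)" using L(4) cin by blast
    show "x \<in> c -` L" using L(3,4) cid by (metis IntD2 subsetD vimageI2)
  qed (use P1 Q1 in \<open>simp_all add: clv cl L compact_imp_closed\<close>)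
  moreover have "c y = y" using cid P1(4,5) by blast
  ultimately show False using L(5) by auto
qed

lemma connected_UN_ball:
  fixes S :: "'a::real_normed_vector set"
  assumes "connected S"
  shows "connected (\<Union>x\<in>S. ball x e)"
proof -
  have "(\<Union>x\<in>S. ball x e) = (\<lambda>z. fst z + snd z) ` (S \<times> ball 0 e)"
  proof (intro equalityI subsetI)
    fix y assume "y \<in> (\<Union>x\<in>S. ball x e)"
    then obtain x where "x \<in> S" "dist x y < e" by auto
    then have "y = fst (x, y - x) + snd (x, y - x)" "(x, y - x) \<in> S \<times> ball 0 e"
      by (auto simp: dist_norm norm_minus_commute)
    then show "y \<in> (\<lambda>z. fst z + snd z) ` (S \<times> ball 0 e)" by (rule image_eqI)
  next
    fix y assume "y \<in> (\<lambda>z. fst z + snd z) ` (S \<times> ball 0 e)"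
    then obtain x v where "x \<in> S" "norm v < e" "y = x + v" by auto
    then show "y \<in> (\<Union>x\<in>S. ball x e)" by (auto simp: dist_norm intro!: bexI[of _ x])
  qed
  moreover have "connected ((\<lambda>z. fst z + snd z) ` (S \<times> ball 0 e))"
    by (intro connected_continuous_image continuous_intros connected_Times assms connected_ball)
  ultimately show ?thesis by simp
qed

text \<open>Disjoint sets would have a positive distance \<open>d\<close>. Small neighbourhoods of
  them are open and connected, hence path connected, and Fashoda's theorem makes a crossing path in
  one meet a crossing path in the other, which puts points of \<open>K\<close> and \<open>V\<close>
  closer than \<open>d\<close>.\<close>

lemma crossing_continua_meet:
  fixes K V :: "(real \<times> real) set"
  assumes V: "closed V" "connected V" "V \<subseteq> {-m..m} \<times> UNIV"
      "t \<in> V" "snd t \<ge> M + 1" "b \<in> V" "snd b \<le> - M - 1"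
    and K: "compact K" "connected K" "K \<subseteq> UNIV \<times> {-M..M}"
      "p \<in> K" "fst p < - m" "q \<in> K" "fst q > m"
  shows "K \<inter> V \<noteq> {}"
proof
  assume "K \<inter> V = {}"
  then obtain d where d: "d > 0" "\<And>x y. x \<in> K \<Longrightarrow> y \<in> V \<Longrightarrow> d \<le> dist x y"
    using separate_compact_closed[OF K(1) V(1)] by auto
  \<comment> \<open>\<open>d / 2\<close> serves the final distance estimate, \<open>1/2\<close>
    keeps the horizontal path strictly below height \<open>M + 1\<close>, and the last two terms
    keep \<open>p\<close> and \<open>q\<close> outside the widened strip of half-width
    \<open>k = m + e\<close>.\<close>
  define e where "e = min (min (d / 2) (1/2)) (min ((- m - fst p) / 2) ((fst q - m) / 2))"
  have e: "e > 0" "e \<le> d / 2" "e \<le> 1/2" "e \<le> (- m - fst p) / 2" "e \<le> (fst q - m) / 2"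
    using d(1) K(5,7) unfolding e_def min_def by - (auto split: if_splits)
  define k where "k = m + e"
  have k: "fst p \<le> - k" "k \<le> fst q" using e unfolding k_def by auto
  have nb: "path_connected (\<Union>x\<in>S. ball x e)" if "connected S" for S :: "(real \<times> real) set"
  proof -
    have "connected (\<Union>x\<in>S. ball x e)" using that by (rule connected_UN_ball)
    moreover have "open (\<Union>x\<in>S. ball x e)" by auto
    ultimately show ?thesis using connected_open_path_connected by blast
  qed
  have "t \<in> (\<Union>x\<in>V. ball x e)" "b \<in> (\<Union>x\<in>V. ball x e)"
    using V(4,6) e(1) by (meson UN_I centre_in_ball)+
  then obtain f where f: "path f" "path_image f \<subseteq> (\<Union>x\<in>V. ball x e)" "pathstart f = b" "pathfinish f = t"
    using nb[OF V(2)] unfolding path_connected_def by metis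
  have "p \<in> (\<Union>x\<in>K. ball x e)" "q \<in> (\<Union>x\<in>K. ball x e)"
    using K(4,6) e(1) by (meson UN_I centre_in_ball)+
  then obtain g where g: "path g" "path_image g \<subseteq> (\<Union>x\<in>K. ball x e)" "pathstart g = p" "pathfinish g = q"
    using nb[OF K(2)] unfolding path_connected_def by metis
  have fb: "\<bar>fst y\<bar> < k" if "y \<in> path_image f" for y
  proof -
    obtain x where x: "x \<in> V" "dist x y < e" using f(2) \<open>y \<in> path_image f\<close> by (meson UN_E mem_ball subsetD)
    then have "\<bar>fst x - fst y\<bar> < e" using dist_fst_le[of x y] by (simp add: dist_real_def)
    moreover have "fst x \<in> {-m..m}" using V(3) x(1) by (metis mem_Times_iff subsetD)
    ultimately show ?thesis unfolding k_def by auto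
  qed
  have gb: "\<bar>snd y\<bar> < M + 1" if "y \<in> path_image g" for y
  proof -
    obtain x where x: "x \<in> K" "dist x y < e" using g(2) \<open>y \<in> path_image g\<close> by (meson UN_E mem_ball subsetD)
    then have "\<bar>snd x - snd y\<bar> < e" using dist_snd_le[of x y] by (simp add: dist_real_def)
    moreover have "snd x \<in> {-M..M}" using K(3) x(1) by (metis mem_Times_iff subsetD)
    ultimately show ?thesis using e(3) by auto
  qed
  have k0: "0 < k" using fb[of b] f(3) pathstart_in_path_image[of f] by fastforce
  have M0: "0 < M + 1" using gb[of p] g(3) pathstart_in_path_image[of g] by fastforce
  \<comment> \<open>Each path is clamped only in the direction in which it crosses the box, which
    puts its ends on the sides of the box. At a common point the clamps are inactive, because each
    path is strictly inside the box in its other direction.\<close>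
  define ff :: "real \<Rightarrow> real^2" where "ff = (\<lambda>s. vector [fst (f s), max (-M-1) (min (M+1) (snd (f s)))])"
  define gg :: "real \<Rightarrow> real^2" where "gg = (\<lambda>s. vector [max (-k) (min k (fst (g s))), snd (g s)])"
  have vec: "continuous_on S (\<lambda>s. vector [u s, v s] :: real^2)"
    if "continuous_on S u" "continuous_on S v" for u v :: "real \<Rightarrow> real" and S
  proof -
    have eq: "(vector [u s, v s] :: real^2) = (\<chi> i. if i = 1 then u s else v s)" for s
      by (simp add: vec_eq_iff forall_2)
    have "continuous_on S (\<lambda>s. if i = 1 then u s else v s)" for i :: 2
      using that by (cases "i = 1") auto
    then show ?thesis unfolding eq by (rule continuous_on_vec_lambda)
  qed
  have pf: "path ff" and pg: "path gg"
    using f(1) g(1) unfolding path_def ff_def gg_def by (auto intro!: vec continuous_intros)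
  obtain z where z: "z \<in> path_image gg" "z \<in> path_image ff"
  proof (rule fashoda[OF pg pf])
    show "path_image gg \<subseteq> cbox (vector [-k, -M-1]) (vector [k, M+1])"
    proof
      fix y assume "y \<in> path_image gg"
      then obtain s where s: "s \<in> {0..1}" "y = gg s" unfolding path_image_def by auto
      then have "\<bar>snd (g s)\<bar> < M + 1" using gb by (auto simp: path_image_def)
      then show "y \<in> cbox (vector [-k, -M-1]) (vector [k, M+1])"
        using k0 s(2) by (auto simp: mem_box_cart forall_2 gg_def)
    qed
    show "path_image ff \<subseteq> cbox (vector [-k, -M-1]) (vector [k, M+1])"
    proof
      fix y assume "y \<in> path_image ff"
      then obtain s where s: "s \<in> {0..1}" "y = ff s" unfolding path_image_def by auto
      then have "\<bar>fst (f s)\<bar> < k" using fb by (auto simp: path_image_def)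
      then show "y \<in> cbox (vector [-k, -M-1]) (vector [k, M+1])"
        using M0 s(2) by (auto simp: mem_box_cart forall_2 ff_def)
    qed
    show "pathstart gg $ 1 = (vector [-k, -M-1] :: real^2) $ 1"
      "pathfinish gg $ 1 = (vector [k, M+1] :: real^2) $ 1"
      using g(3,4) k k0 by (auto simp: pathstart_def pathfinish_def gg_def)
    show "pathstart ff $ 2 = (vector [-k, -M-1] :: real^2) $ 2"
      "pathfinish ff $ 2 = (vector [k, M+1] :: real^2) $ 2"
      using f(3,4) V M0 by (auto simp: pathstart_def pathfinish_def ff_def)
  qed auto
  then obtain r s where r: "r \<in> {0..1}" "s \<in> {0..1}" "gg r = ff s" unfolding path_image_def by auto
  then have gr: "g r \<in> path_image g" and fs: "f s \<in> path_image f" by (auto simp: path_image_def)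
  have "gg r $ 1 = ff s $ 1" "gg r $ 2 = ff s $ 2" using r by auto
  then have "fst (g r) = fst (f s)" "snd (g r) = snd (f s)"
    using fb[OF fs] gb[OF gr] by (auto simp: gg_def ff_def max_def min_def split: if_splits)
  then have eq: "g r = f s" by (simp add: prod_eq_iff)
  obtain x where x: "x \<in> K" "dist x (g r) < e" using g(2) gr by (meson UN_E mem_ball subsetD)
  obtain y where y: "y \<in> V" "dist y (f s) < e" using f(2) fs by (meson UN_E mem_ball subsetD)
  have "dist x y < d" using x y e(2) unfolding eq by (smt (verit) dist_triangle2 field_sum_of_halves)
  then show False using d(2) x y by fastforce
qed

section \<open>Translates of a compact set\<close>

lemma Tpow_Tpow [simp]: "Tpow m (Tpow n p) = Tpow (m + n) p"
  by (simp add: Tpow_def)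

lemma Tpow_0 [simp]: "Tpow 0 p = p"
  by (simp add: Tpow_def)

lemma fst_Tpow [simp]: "fst (Tpow n p) = fst p + of_int n"
  and snd_Tpow [simp]: "snd (Tpow n p) = snd p"
  by (simp_all add: Tpow_def)

lemma Tpow_image_Tpow_image [simp]: "Tpow m ` Tpow n ` S = Tpow (m + n) ` S"
  by (simp add: image_image)

lemma Tpow_image_0 [simp]: "Tpow 0 ` S = S"
  by (simp add: image_def)

lemma Tpow_image_iff: "p \<in> Tpow n ` S \<longleftrightarrow> Tpow (- n) p \<in> S"
proof
  assume "Tpow (- n) p \<in> S"
  then have "Tpow n (Tpow (- n) p) \<in> Tpow n ` S" by (rule imageI)
  then show "p \<in> Tpow n ` S" by simp
qed auto

lemma continuous_on_Tpow: "continuous_on S (Tpow n)"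
  unfolding Tpow_def by (intro continuous_intros)

lemma connected_Tpow_image: "connected S \<Longrightarrow> connected (Tpow n ` S)"
  by (rule connected_continuous_image[OF continuous_on_Tpow])

lemma compact_Tpow_image: "compact S \<Longrightarrow> compact (Tpow n ` S)"
  by (rule compact_continuous_image[OF continuous_on_Tpow])

lemma closed_Tpow_image: "closed S \<Longrightarrow> closed (Tpow n ` S)"
proof -
  assume "closed S"
  then have "closed (Tpow (- n) -` S)" using closed_vimage[OF _ continuous_on_Tpow] by blast
  moreover have "Tpow (- n) -` S = Tpow n ` S" by (auto simp: Tpow_image_iff)
  ultimately show ?thesis by simp
qed

lemma connected_component_Tpow:
  assumes "connected_component S x y"
  shows "connected_component (Tpow n ` S) (Tpow n x) (Tpow n y)"
proof -
  obtain W where "connected W" "W \<subseteq> S" "x \<in> W" "y \<in> W"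
    using assms unfolding connected_component_def by blast
  then show ?thesis unfolding connected_component_def
    by (intro exI[of _ "Tpow n ` W"]) (auto intro: connected_Tpow_image)
qed

definition translates :: "int set \<Rightarrow> (real \<times> real) set \<Rightarrow> (real \<times> real) set" where
  "translates I G = (\<Union>n\<in>I. Tpow n ` G)"

text \<open>The union is the sum of a compact set and a closed set of integer vectors, so it is
  closed for infinite \<open>I\<close> as well.\<close>

lemma closed_translates: "compact G \<Longrightarrow> closed (translates I G)"
proof -
  assume "compact G"
  have "closed ((of_int ` I :: real set) \<times> {0::real})"
    by (intro closed_Times closed_of_int_image closed_singleton)
  with \<open>compact G\<close> have "closed (\<Union>x\<in>G. \<Union>y\<in>of_int ` I \<times> {0}. {x + y})"
    by (rule compact_closed_sums)
  moreover have "(\<Union>x\<in>G. \<Union>y\<in>of_int ` I \<times> {0}. {x + y}) = translates I G"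
  proof (intro equalityI subsetI)
    fix p assume "p \<in> (\<Union>x\<in>G. \<Union>y\<in>of_int ` I \<times> {0}. {x + y})"
    then obtain x n where "x \<in> G" "n \<in> I" "p = x + (of_int n, 0)" by blast
    then have "n \<in> I" "p = Tpow n x" "x \<in> G" by (auto simp: Tpow_def prod_eq_iff)
    then show "p \<in> translates I G" unfolding translates_def by blast
  next
    fix p assume "p \<in> translates I G"
    then obtain x n where "x \<in> G" "n \<in> I" "p = Tpow n x" unfolding translates_def by blast
    then have "x \<in> G" "(of_int n, 0) \<in> of_int ` I \<times> {0::real}" "p = x + (of_int n, 0)"
      by (auto simp: Tpow_def prod_eq_iff)
    then show "p \<in> (\<Union>x\<in>G. \<Union>y\<in>of_int ` I \<times> {0}. {x + y})" by blast
  qed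
  ultimately show ?thesis by simp
qed

lemma compact_translates: "compact G \<Longrightarrow> finite I \<Longrightarrow> compact (translates I G)"
  unfolding translates_def by (intro compact_UN compact_Tpow_image) auto

lemma Tpow_translates_UNIV: "p \<in> translates UNIV G \<Longrightarrow> Tpow k p \<in> translates UNIV G"
proof -
  assume "p \<in> translates UNIV G"
  then obtain n x where "x \<in> G" "p = Tpow n x" unfolding translates_def by blast
  then have "Tpow k p = Tpow (k + n) x" "x \<in> G" by simp_all
  then show ?thesis unfolding translates_def by blast
qed

text \<open>Consecutive translates overlap, so they form a chain.\<close>

lemma connected_translates_atLeastAtMost:
  assumes "connected H" "H \<inter> Tpow 1 ` H \<noteq> {}"
  shows "connected (translates {a..b} H)"
proof (cases "a \<le> b")
  case True
  have "connected (translates {a..a + int n} H)" for n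
  proof (induction n)
    case 0
    then show ?case using connected_Tpow_image[OF assms(1)] by (simp add: translates_def)
  next
    case (Suc n)
    have "{a..a + int (Suc n)} = insert (a + int n + 1) {a..a + int n}" by auto
    then have eq: "translates {a..a + int (Suc n)} H = translates {a..a + int n} H \<union> Tpow (a + int n + 1) ` H"
      by (auto simp: translates_def)
    obtain p where "p \<in> H" "p \<in> Tpow 1 ` H" using assms(2) by blast
    then have "Tpow (a + int n) p \<in> Tpow (a + int n) ` H" "Tpow (a + int n) p \<in> Tpow (a + int n + 1) ` H"
      by (auto simp: image_image)
    moreover have "a + int n \<in> {a..a + int n}" by simp
    ultimately have "translates {a..a + int n} H \<inter> Tpow (a + int n + 1) ` H \<noteq> {}"
      unfolding translates_def by blast
    then show ?case unfolding eq
      by (rule connected_Un[OF Suc connected_Tpow_image[OF assms(1)]])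
  qed
  from this[of "nat (b - a)"] True show ?thesis by simp
qed (simp add: translates_def)

text \<open>
  All translates of \<open>G\<close> have the same heights. If a separating component \<open>Y\<close> were disjoint from a
  translate of itself, vertical rays from a highest and a lowest point of \<open>Y\<close> together with \<open>Y\<close>
  would join top and bottom off that translate.
\<close>

lemma translates_separating_connected:
  assumes G: "compact G" "connected G" and X: "X = translates UNIV G"
    and bd: "X \<subseteq> UNIV \<times> {-M..M}"
    and sep: "\<not> connected_component (- X) (0, M + 1) (0, - M - 1)"
  shows "connected X"
proof -
  have clX: "closed X" using X closed_translates G by blast
  \<comment> \<open>A closed set separating two points has a component that already separates them;
    the aim is to show that \<open>Y\<close> is all of \<open>X\<close>.\<close>
  obtain Y where Y: "Y \<in> components X" "\<not> connected_component (- Y) (0, M + 1) (0, - M - 1)"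
    using separation_by_component_closed_pointwise[OF clX sep] by blast
  have YX: "Y \<subseteq> X" "connected Y" "Y \<noteq> {}"
    using Y(1) by (auto simp: in_components_subset in_components_connected in_components_nonempty)
  have Ymax: "Z \<subseteq> Y" if "connected Z" "Z \<subseteq> X" "Z \<inter> Y \<noteq> {}" for Z
    using components_maximal[OF Y(1) that(1,2)] that(3) by blast
  obtain p where p: "p \<in> Y" using YX by blast
  then obtain n where n: "p \<in> Tpow n ` G" using YX X unfolding translates_def by blast
  define G' where "G' = Tpow n ` G"
  have G': "compact G'" "connected G'" "G' \<noteq> {}" "G' \<subseteq> Y"
  proof -
    show "compact G'" "connected G'" "G' \<noteq> {}"
      using G n by (auto simp: G'_def compact_Tpow_image connected_Tpow_image)
    have "G' \<subseteq> X" using X by (auto simp: G'_def translates_def)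
    then show "G' \<subseteq> Y" using Ymax[of G'] \<open>connected G'\<close> n p by (auto simp: G'_def)
  qed
  have snd_X: "\<exists>g\<in>G'. snd g = snd x" if x: "x \<in> X" for x
  proof -
    obtain k g where kg: "g \<in> G" "x = Tpow k g" using x X by (auto simp: translates_def)
    then have "Tpow n g \<in> G'" "snd (Tpow n g) = snd x" by (auto simp: G'_def)
    then show ?thesis by blast
  qed
  have cont: "continuous_on G' snd" by (intro continuous_intros)
  \<comment> \<open>Shifts keep heights, so \<open>u\<close> and \<open>v\<close> are a highest and
    a lowest point not only of \<open>G'\<close> but of all of \<open>X\<close>.\<close>
  obtain u where u: "u \<in> G'" "\<And>g. g \<in> G' \<Longrightarrow> snd g \<le> snd u"
    using continuous_attains_sup[OF G'(1,3) cont] by blast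
  obtain v where v: "v \<in> G'" "\<And>g. g \<in> G' \<Longrightarrow> snd v \<le> snd g"
    using continuous_attains_inf[OF G'(1,3) cont] by blast
  have meet: "Y \<inter> Tpow k ` Y \<noteq> {}" for k
  proof
    assume disj: "Y \<inter> Tpow k ` Y = {}"
    let ?Z = "Tpow k ` Y"
    have ZX: "?Z \<subseteq> X" using YX X Tpow_translates_UNIV by blast
    have seg: "connected_component (- ?Z) x y"
      if "closed_segment x y \<inter> ?Z = {}" for x y
      unfolding connected_component_def using that
      by (intro exI[of _ "closed_segment x y"]) auto
    have hor: "connected_component (- ?Z) (x, s) (y, s)" if "s > M \<or> s < - M" for x y s
    proof (rule seg)
      have "closed_segment (x, s) (y, s) \<subseteq> UNIV \<times> {s}"
        by (rule closed_segment_subset) (auto intro: convex_Times)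
      then show "closed_segment (x, s) (y, s) \<inter> ?Z = {}" using ZX bd that by fastforce
    qed
    have uM: "snd u \<in> {-M..M}" "snd v \<in> {-M..M}"
      using G'(4) u(1) v(1) YX(1) bd by (metis mem_Times_iff subsetD)+
    have "connected_component (- ?Z) u (fst u, M + 1)"
    proof (rule seg)
      have "closed_segment u (fst u, M + 1) \<subseteq> {fst u} \<times> {snd u..}"
        using uM by (intro closed_segment_subset convex_Times) (auto simp: mem_Times_iff)
      \<comment> \<open>A point of \<open>?Z\<close> on this ray is no higher than \<open>u\<close>,
        so it could only be \<open>u\<close> itself, which lies in the disjoint set
        \<open>Y\<close>.\<close>
      moreover have "({fst u} \<times> {snd u..}) \<inter> ?Z = {}"
      proof (rule equals0I)
        fix z assume "z \<in> ({fst u} \<times> {snd u..}) \<inter> ?Z"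
        then have z: "z \<in> ?Z" "fst z = fst u" "snd z \<ge> snd u"
          by (simp_all only: Int_iff mem_Times_iff singleton_iff atLeast_iff atMost_iff)
        then have "snd z \<le> snd u" using snd_X[of z] ZX u(2) by (metis subsetD)
        then have "z = u" using z by (simp add: prod_eq_iff)
        then show False using z(1) u(1) G'(4) disj by blast
      qed
      ultimately show "closed_segment u (fst u, M + 1) \<inter> ?Z = {}" by blast
    qed
    moreover have "connected_component (- ?Z) v (fst v, - M - 1)"
    proof (rule seg)
      have "closed_segment v (fst v, - M - 1) \<subseteq> {fst v} \<times> {..snd v}"
        using uM by (intro closed_segment_subset convex_Times) (auto simp: mem_Times_iff)
      moreover have "({fst v} \<times> {..snd v}) \<inter> ?Z = {}"
      proof (rule equals0I)
        fix z assume "z \<in> ({fst v} \<times> {..snd v}) \<inter> ?Z"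
        then have z: "z \<in> ?Z" "fst z = fst v" "snd z \<le> snd v"
          by (simp_all only: Int_iff mem_Times_iff singleton_iff atLeast_iff atMost_iff)
        then have "snd z \<ge> snd v" using snd_X[of z] ZX v(2) by (metis subsetD)
        then have "z = v" using z by (simp add: prod_eq_iff)
        then show False using z(1) v(1) G'(4) disj by blast
      qed
      ultimately show "closed_segment v (fst v, - M - 1) \<inter> ?Z = {}" by blast
    qed
    moreover have "connected_component (- ?Z) u v"
      unfolding connected_component_def using YX u(1) v(1) G'(4) disj by blast
    moreover have "connected_component (- ?Z) (of_int k, M + 1) (fst u, M + 1)"
      "connected_component (- ?Z) (fst v, - M - 1) (of_int k, - M - 1)"
      by (auto intro: hor)
    ultimately have "connected_component (- ?Z) (of_int k, M + 1) (of_int k, - M - 1)"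
      by (meson connected_component_sym connected_component_trans)
    \<comment> \<open>Shifting back by \<open>k\<close> turns \<open>?Z\<close> into
      \<open>Y\<close>; the ends were taken at abscissa \<open>k\<close> so that they return to
      \<open>0\<close>.\<close>
    from connected_component_Tpow[OF this, of "- k"]
    have "connected_component (Tpow (- k) ` (- ?Z)) (0, M + 1) (0, - M - 1)"
      by (simp add: Tpow_def)
    moreover have "Tpow (- k) ` (- ?Z) \<subseteq> - Y" by (auto simp: Tpow_image_iff)
    ultimately show False using Y(2) connected_component_of_subset by blast
  qed
  have "x \<in> Y" if x: "x \<in> X" for x
  proof -
    obtain k where "x \<in> Tpow k ` G" using x X by (auto simp: translates_def)
    then have "x \<in> Tpow (k - n) ` G'" by (simp add: G'_def)
    then have "x \<in> Tpow (k - n) ` Y" using G'(4) by blast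
    moreover have "Tpow (k - n) ` Y \<subseteq> X" using YX X Tpow_translates_UNIV by blast
    ultimately show ?thesis
      using Ymax[OF connected_Tpow_image[OF YX(2)]] meet by (metis Int_commute subsetD)
  qed
  then have "X = Y" using YX by blast
  then show ?thesis using YX by simp
qed

text \<open>\<open>I\<close> collects the shifts \<open>n\<close> for which \<open>G\<close> and its
  translate by \<open>n\<close> lie in one continuum inside \<open>X\<close>. Translates with index
  in \<open>I\<close> never meet the others, and both unions are closed, so connectedness of
  \<open>X\<close> gives \<open>I = UNIV\<close>. A continuum witnessing \<open>1 \<in> I\<close> is
  the new generator.\<close>

lemma linked_generator:
  assumes G: "compact G" "connected G" "G \<noteq> {}" and X: "X = translates UNIV G" and con: "connected X"
  obtains H where "compact H" "connected H" "X = translates UNIV H" "H \<inter> Tpow 1 ` H \<noteq> {}"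
proof -
  define I where "I = {n. \<exists>K. compact K \<and> connected K \<and> K \<subseteq> X \<and> G \<subseteq> K \<and> Tpow n ` G \<subseteq> K}"
  have sub: "Tpow n ` G \<subseteq> X" for n using X by (auto simp: translates_def)
  have 0: "0 \<in> I" unfolding I_def using G sub[of 0] by auto
  have step: "n \<in> I" if m: "m \<in> I" and ne: "Tpow m ` G \<inter> Tpow n ` G \<noteq> {}" for m n
  proof -
    obtain K where K: "compact K" "connected K" "K \<subseteq> X" "G \<subseteq> K" "Tpow m ` G \<subseteq> K"
      using m unfolding I_def by blast
    have "connected (K \<union> Tpow n ` G)"
      using K(2,5) ne by (intro connected_Un connected_Tpow_image G) blast+
    moreover have "compact (K \<union> Tpow n ` G)"
      by (intro compact_Un compact_Tpow_image G K)
    ultimately have "compact (K \<union> Tpow n ` G) \<and> connected (K \<union> Tpow n ` G) \<and> K \<union> Tpow n ` G \<subseteq> X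
        \<and> G \<subseteq> K \<union> Tpow n ` G \<and> Tpow n ` G \<subseteq> K \<union> Tpow n ` G" using K sub by auto
    then show ?thesis unfolding I_def by blast
  qed
  have "translates I G \<inter> translates (- I) G = {}"
    unfolding translates_def using step by blast
  moreover have XU: "X \<subseteq> translates I G \<union> translates (- I) G"
    unfolding X translates_def by blast
  moreover have "translates I G \<inter> X \<noteq> {}"
  proof -
    have "Tpow 0 ` G \<subseteq> translates I G" "Tpow 0 ` G \<subseteq> X" "Tpow 0 ` G \<noteq> {}"
      using 0 sub[of 0] G unfolding translates_def by blast+
    then show ?thesis by blast
  qed
  ultimately have "translates (- I) G \<inter> X = {}"
    using con closed_translates[OF G(1)] unfolding connected_closed by blast
  then have "- I = {}"
    using sub G(3) unfolding translates_def by blast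
  then have "1 \<in> I" by auto
  then obtain K where K: "compact K" "connected K" "K \<subseteq> X" "G \<subseteq> K" "Tpow 1 ` G \<subseteq> K"
    unfolding I_def by blast
  have "translates UNIV K \<subseteq> X"
    using K(3) Tpow_translates_UNIV unfolding X translates_def[of _ K] by blast
  moreover have "X \<subseteq> translates UNIV K"
    using K(4) unfolding X translates_def by blast
  moreover have "K \<inter> Tpow 1 ` K \<noteq> {}" using K(4,5) G(3) by blast
  ultimately show ?thesis using that K by blast
qed

section \<open>Joining points off a generated set within a vertical strip\<close>

text \<open>The point is that \<open>R\<close> depends on \<open>a\<close> only and not on
  \<open>z\<close> and \<open>w\<close>. Two vertical walls at distance \<open>R\<close>, together
  with the part \<open>S\<close> of \<open>X\<close> between them, enclose the strip component of
  \<open>z\<close> if it stays away from \<open>w\<close>; Janiszewski's theorem shows that they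
  cannot separate \<open>z\<close> from \<open>w\<close>.\<close>

lemma translates_component_in_strip:
  assumes H: "compact H" "connected H" "H \<inter> Tpow 1 ` H \<noteq> {}" and X: "X = translates UNIV H"
    and bd: "X \<subseteq> UNIV \<times> {-M..M}"
    and sep: "\<not> connected_component (- X) (0, M + 1) (0, - M - 1)"
    and a: "0 \<le> a"
  obtains R where "R > a" "\<And>z w. \<lbrakk>\<bar>fst z\<bar> \<le> a; \<bar>fst w\<bar> \<le> a; \<bar>snd w\<bar> \<ge> M + 1;
    connected_component (- X) z w\<rbrakk> \<Longrightarrow> connected_component (- X \<inter> {-R<..<R} \<times> UNIV) z w"
proof -
  have "bounded (fst ` H)" using H(1) compact_imp_bounded bounded_fst by blast
  then obtain h0 where h0: "\<And>p. p \<in> H \<Longrightarrow> \<bar>fst p\<bar> \<le> h0" unfolding bounded_iff by auto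
  obtain h :: nat where "h0 \<le> real h" using real_arch_simple by blast
  then have h: "\<bar>fst p\<bar> \<le> real h" if "p \<in> H" for p using h0[OF that] by linarith
  obtain N0 :: nat where "a + real h + 1 \<le> real N0" using real_arch_simple by blast
  define N where "N = int N0"
  have N: "a + real h + 1 \<le> of_int N" using \<open>_ \<le> real N0\<close> by (simp add: N_def)
  \<comment> \<open>Translates of index at least \<open>N\<close> in absolute value stay beyond
    \<open>a\<close>; those that reach a wall at distance \<open>R\<close> have such an index; and
    those that meet the strip at all have index at most \<open>Q\<close> in absolute value, so
    \<open>S\<close> is all of \<open>X\<close> over the strip.\<close>
  define Q where "Q = N + 2 * int h + 3"
  define R where "R = real_of_int N + real h + 1"
  have fstT: "of_int n - real h \<le> fst p" "fst p \<le> of_int n + real h" if "p \<in> Tpow n ` H" for n p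
    using h[of "Tpow (- n) p"] that by (auto simp: Tpow_image_iff)
  define S where "S = translates {-Q..Q} H"
  define sL where "sL = {-R} \<times> {-M-1..M+1}"
  define sR where "sR = {R} \<times> {-M-1..M+1}"
  define tL where "tL = translates {-Q..-N} H"
  define tR where "tR = translates {N..Q} H"
  have comp: "compact S" "compact sL" "compact sR" "compact tL" "compact tR"
    unfolding S_def sL_def sR_def tL_def tR_def
    by (auto intro!: compact_translates H compact_Times)
  have contL: "connected tL" and contR: "connected tR"
    unfolding tL_def tR_def by (auto intro: connected_translates_atLeastAtMost[OF H(2,3)])
  have SX: "S \<subseteq> X" unfolding S_def X translates_def by blast
  have tLS: "tL \<subseteq> S" and tRS: "tR \<subseteq> S"
    unfolding tL_def tR_def S_def translates_def
    using N a by (intro UN_mono; force simp: Q_def)+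
  have tLf: "fst p < - a" if "p \<in> tL" for p
  proof -
    obtain n where "n \<in> {-Q..-N}" "p \<in> Tpow n ` H" using \<open>p \<in> tL\<close> unfolding tL_def translates_def by blast
    then have "fst p \<le> of_int n + real h" "real_of_int n \<le> - of_int N" using fstT by auto
    then show ?thesis using N by linarith
  qed
  have tRf: "fst p > a" if "p \<in> tR" for p
  proof -
    obtain n where "n \<in> {N..Q}" "p \<in> Tpow n ` H" using \<open>p \<in> tR\<close> unfolding tR_def translates_def by blast
    then have "fst p \<ge> of_int n - real h" "real_of_int n \<ge> of_int N" using fstT by auto
    then show ?thesis using N by linarith
  qed
  have Ra: "R > a" unfolding R_def using N by linarith
  have SsL: "S \<inter> sL \<subseteq> tL"
  proof
    fix p assume p: "p \<in> S \<inter> sL"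
    then obtain n where n: "n \<in> {-Q..Q}" "p \<in> Tpow n ` H" unfolding S_def translates_def by blast
    have "fst p = - R" using p by (auto simp: sL_def)
    then have "real_of_int n \<le> of_int (- N)" using fstT[OF n(2)] unfolding R_def by auto
    then have "n \<in> {-Q..-N}" using n(1) by (simp only: of_int_le_iff atLeastAtMost_iff)
    then show "p \<in> tL" using n(2) unfolding tL_def translates_def by blast
  qed
  have SsR: "S \<inter> sR \<subseteq> tR"
  proof
    fix p assume p: "p \<in> S \<inter> sR"
    then obtain n where n: "n \<in> {-Q..Q}" "p \<in> Tpow n ` H" unfolding S_def translates_def by blast
    have "fst p = R" using p by (auto simp: sR_def)
    then have "real_of_int n \<ge> of_int N" using fstT[OF n(2)] unfolding R_def by auto
    then have "n \<in> {N..Q}" using n(1) by (simp only: of_int_le_iff atLeastAtMost_iff)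
    then show "p \<in> tR" using n(2) unfolding tR_def translates_def by blast
  qed
  have XS: "p \<in> S" if p: "p \<in> X" "\<bar>fst p\<bar> \<le> R" for p
  proof -
    obtain n where n: "p \<in> Tpow n ` H" using p(1) unfolding X translates_def by blast
    then have "real_of_int n \<le> of_int Q" "of_int (- Q) \<le> real_of_int n"
      using fstT[OF n] p(2) unfolding R_def Q_def by auto
    then have "n \<in> {-Q..Q}" by (simp only: of_int_le_iff atLeastAtMost_iff)
    then show ?thesis using n unfolding S_def translates_def by blast
  qed
  have "connected_component (- X \<inter> {-R<..<R} \<times> UNIV) z w"
    if zw: "\<bar>fst z\<bar> \<le> a" "\<bar>fst w\<bar> \<le> a" "\<bar>snd w\<bar> \<ge> M + 1" and cc: "connected_component (- X) z w" for z w
  proof (rule ccontr)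
    let ?B = "- X \<inter> {-R<..<R} \<times> UNIV"
    let ?W = "connected_component_set ?B z"
    assume nw: "\<not> connected_component ?B z w"
    have mid: "connected_component (- F) z w" if F: "\<And>p. p \<in> F \<Longrightarrow> \<bar>fst p\<bar> > a" for F
    proof -
      have "connected ({-a..a} \<times> (UNIV :: real set))" by (intro connected_Times) auto
      moreover have "{-a..a} \<times> UNIV \<subseteq> - F" using F by fastforce
      moreover have "z \<in> {-a..a} \<times> UNIV" "w \<in> {-a..a} \<times> UNIV" using zw by (auto simp: mem_Times_iff)
      ultimately show ?thesis unfolding connected_component_def by blast
    qed
    txt \<open>The side barriers \<open>sL\<close>, \<open>sR\<close> are thickened by the chains \<open>tL\<close>, \<open>tR\<close> to make the
      intersections in Janiszewski's theorem connected.\<close>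
    have "connected_component (- (S \<union> (sL \<union> tL))) z w"
    proof (rule Janiszewski_real2)
      have "S \<inter> (sL \<union> tL) = tL" using SsL tLS by blast
      then show "connected (S \<inter> (sL \<union> tL))" using contL by simp
      show "connected_component (- S) z w"
        using cc SX connected_component_of_subset by (metis Compl_subset_Compl_iff)
      show "connected_component (- (sL \<union> tL)) z w"
      proof (rule mid)
        fix p assume "p \<in> sL \<union> tL"
        then show "\<bar>fst p\<bar> > a" using tLf[of p] Ra a by (auto simp: sL_def)
      qed
    qed (use comp in \<open>auto intro: compact_imp_closed\<close>)
    moreover have "S \<union> (sL \<union> tL) = S \<union> sL" using tLS by blast
    ultimately have 1: "connected_component (- (S \<union> sL)) z w" by simp
    have "connected_component (- ((S \<union> sL) \<union> (sR \<union> tR))) z w"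
    proof (rule Janiszewski_real2[OF _ _ _ 1])
      have "sL \<inter> (sR \<union> tR) = {}" using tRf Ra a by (force simp: sL_def sR_def)
      then have "(S \<union> sL) \<inter> (sR \<union> tR) = tR" using SsR tRS by blast
      then show "connected ((S \<union> sL) \<inter> (sR \<union> tR))" using contR by simp
      show "connected_component (- (sR \<union> tR)) z w"
      proof (rule mid)
        fix p assume "p \<in> sR \<union> tR"
        then show "\<bar>fst p\<bar> > a" using tRf[of p] Ra a by (auto simp: sR_def)
      qed
    qed (use comp in \<open>auto intro: compact_imp_closed\<close>)
    then obtain \<Gamma> where \<Gamma>: "connected \<Gamma>" "\<Gamma> \<subseteq> - ((S \<union> sL) \<union> (sR \<union> tR))" "z \<in> \<Gamma>" "w \<in> \<Gamma>"
      unfolding connected_component_def by blast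
    have zB: "z \<in> ?B" "w \<in> ?B" using cc zw Ra connected_component_in[OF cc] by (auto simp: mem_Times_iff)
    have top: "connected ({-R<..<R} \<times> {M+1..})" "connected ({-R<..<R} \<times> {..-M-1})"
      by (intro connected_Times; simp)+
    have topB: "{-R<..<R} \<times> {M+1..} \<subseteq> ?B" "{-R<..<R} \<times> {..-M-1} \<subseteq> ?B" using bd by fastforce+
    have R0: "0 < R" using Ra a by simp
    \<comment> \<open>If the component of \<open>z\<close> reached the end of \<open>w\<close> it
      would contain \<open>w\<close>; if it reached the opposite end, top and bottom would be joined
      off \<open>X\<close>, against \<open>sep\<close>.\<close>
    have low: "\<bar>snd p\<bar> < M + 1" if p: "p \<in> ?W" for p
    proof (rule ccontr)
      assume "\<not> \<bar>snd p\<bar> < M + 1"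
      then have pc: "snd p \<ge> M + 1 \<or> snd p \<le> - M - 1" by auto
      have zp: "connected_component ?B z p" using p by simp
      then have pB: "p \<in> ?B" using connected_component_in by blast
      then have pf: "fst p \<in> {-R<..<R}" by (simp add: mem_Times_iff)
      have wf: "fst w \<in> {-R<..<R}" using zB by (simp add: mem_Times_iff)
      have up: "connected_component ?B x y" if "snd x \<ge> M + 1" "snd y \<ge> M + 1"
          "fst x \<in> {-R<..<R}" "fst y \<in> {-R<..<R}" for x y
      proof -
        have "x \<in> {-R<..<R} \<times> {M+1..}" "y \<in> {-R<..<R} \<times> {M+1..}" using that by (simp_all add: mem_Times_iff)
        then show ?thesis unfolding connected_component_def using top(1) topB(1) by blast
      qed
      have dn: "connected_component ?B x y" if "snd x \<le> - M - 1" "snd y \<le> - M - 1"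
          "fst x \<in> {-R<..<R}" "fst y \<in> {-R<..<R}" for x y
      proof -
        have "x \<in> {-R<..<R} \<times> {..-M-1}" "y \<in> {-R<..<R} \<times> {..-M-1}" using that by (simp_all add: mem_Times_iff)
        then show ?thesis unfolding connected_component_def using top(2) topB(2) by blast
      qed
      have npw: "\<not> connected_component ?B p w" using zp nw connected_component_trans by blast
      have BX: "connected_component (- X) x y" if "connected_component ?B x y" for x y
        using that connected_component_of_subset by (metis Int_lower1)
      have pw: "connected_component (- X) p w"
        using BX[OF zp] cc connected_component_sym connected_component_trans by metis
      have f0: "fst (0, c) \<in> {-R<..<R}" for c :: real using R0 by simp
      show False
      proof (cases "snd w \<ge> M + 1")
        case True
        then have lp: "snd p \<le> - M - 1" using pc npw up pf wf by blast
        have "connected_component ?B (0, M + 1) w" "connected_component ?B p (0, - M - 1)"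
          using True lp pf wf f0 up[of "(0, M + 1)" w] dn[of p "(0, - M - 1)"] by auto
        then show False using sep BX pw by (meson connected_component_sym connected_component_trans)
      next
        case False
        then have lw: "snd w \<le> - M - 1" using zw(3) by auto
        then have lp: "snd p \<ge> M + 1" using pc npw dn pf wf by blast
        have "connected_component ?B (0, M + 1) p" "connected_component ?B w (0, - M - 1)"
          using lw lp pf wf f0 up[of "(0, M + 1)" p] dn[of w "(0, - M - 1)"] by auto
        then show False using sep BX pw by (meson connected_component_trans)
      qed
    qed
    \<comment> \<open>\<open>\<Gamma>\<close> leaves \<open>?W\<close> and so crosses its frontier.
      As \<open>?W\<close> is open and relatively closed in \<open>?B\<close>, a frontier point is
      outside \<open>?B\<close>, hence in \<open>X\<close> or on a side line, and by
      \<open>low\<close> no higher than the walls: it lies in \<open>S\<close>, \<open>sL\<close> or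
      \<open>sR\<close>, all avoided by \<open>\<Gamma>\<close>.\<close>
    have "z \<in> ?W" using zB by simp
    then have "\<Gamma> \<inter> ?W \<noteq> {}" using \<Gamma>(3) by blast
    moreover have "\<Gamma> - ?W \<noteq> {}" using \<Gamma>(4) nw by auto
    ultimately have "\<Gamma> \<inter> frontier ?W \<noteq> {}" by (rule connected_Int_frontier[OF \<Gamma>(1)])
    then obtain p where p: "p \<in> \<Gamma>" "p \<in> frontier ?W" by blast
    have "?W \<subseteq> {-R..R} \<times> {-M-1..M+1}"
    proof
      fix q assume q: "q \<in> ?W"
      then have "q \<in> ?B" using connected_component_subset by blast
      then show "q \<in> {-R..R} \<times> {-M-1..M+1}" using low[OF q] by (auto simp: mem_Times_iff)
    qed
    then have "closure ?W \<subseteq> {-R..R} \<times> {-M-1..M+1}"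
      by (intro closure_minimal closed_Times) auto
    moreover have pcl: "p \<in> closure ?W" using p(2) by (simp add: frontier_def)
    ultimately have pb: "p \<in> {-R..R} \<times> {-M-1..M+1}" by blast
    have clX: "closed X" using X closed_translates H by blast
    have oB: "open ?B" using clX by (intro open_Int open_Times) auto
    have "open ?W" using oB by (rule open_connected_component)
    then have "p \<notin> ?W" using p(2) by (simp add: frontier_def interior_open)
    moreover have "closure ?W \<inter> ?B \<subseteq> ?W"
    proof -
      have "closedin (top_of_set ?B) ?W" by (rule closedin_connected_component)
      then obtain F where F: "closed F" "?W = ?B \<inter> F" unfolding closedin_closed by blast
      then have "closure ?W \<subseteq> F" by (metis Int_lower2 closure_minimal)
      then show ?thesis using F(2) by blast
    qed
    ultimately have "p \<notin> ?B" using pcl by blast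
    then have "p \<in> X \<or> fst p = R \<or> fst p = - R" using pb by (auto simp: mem_Times_iff)
    moreover have "\<bar>fst p\<bar> \<le> R" using pb by (auto simp: mem_Times_iff)
    ultimately have "p \<in> S \<union> sL \<union> sR"
      using XS[of p] pb by (auto simp: mem_Times_iff sL_def sR_def)
    then show False using p(1) \<Gamma>(2) by blast
  qed
  then show ?thesis using that Ra by blast
qed

text \<open>\<open>E\<close> contains all of \<open>X\<close> over a fundamental domain of the
  shift, so the translates of its closure fill \<open>X\<close>; the closure is compact since both
  coordinates are bounded on \<open>E\<close>.\<close>

lemma invariant_generated:
  assumes "closed X" and inv: "\<And>n p. p \<in> X \<Longrightarrow> Tpow n p \<in> X" and bd: "X \<subseteq> UNIV \<times> {-M..M}"
    and E: "connected E" "E \<subseteq> X" "E \<subseteq> {-R..R} \<times> UNIV" "X \<inter> {0..1} \<times> UNIV \<subseteq> E"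
  obtains G where "compact G" "connected G" "X = translates UNIV G"
proof -
  let ?G = "closure E"
  have "?G \<subseteq> X" using E(2) assms(1) by (rule closure_minimal)
  moreover have "X = translates UNIV ?G"
  proof (intro equalityI subsetI)
    fix x assume "x \<in> X"
    let ?n = "\<lfloor>fst x\<rfloor>"
    have "Tpow (- ?n) x \<in> X \<inter> {0..1} \<times> UNIV"
      using inv[OF \<open>x \<in> X\<close>, of "- ?n"] by (auto simp: mem_Times_iff) linarith+
    then have "Tpow (- ?n) x \<in> ?G" using E(4) closure_subset[of E] by (meson subsetD)
    then have "x \<in> Tpow ?n ` ?G" by (simp add: Tpow_image_iff)
    then show "x \<in> translates UNIV ?G" unfolding translates_def by blast
  next
    fix x assume "x \<in> translates UNIV ?G"
    then obtain n y where "y \<in> ?G" "x = Tpow n y" unfolding translates_def by blast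
    then show "x \<in> X" using inv \<open>?G \<subseteq> X\<close> by (metis subsetD)
  qed
  moreover have "E \<subseteq> {-R..R} \<times> {-M..M}"
  proof
    fix p assume "p \<in> E"
    then have "p \<in> {-R..R} \<times> UNIV" "p \<in> UNIV \<times> {-M..M}" using E(2,3) bd by (meson subsetD)+
    then show "p \<in> {-R..R} \<times> {-M..M}" by (simp add: mem_Times_iff)
  qed
  then have "bounded E" by (rule bounded_subset[rotated]) (intro bounded_Times bounded_closed_interval)
  then have "compact ?G" by (simp add: compact_closure)
  ultimately show ?thesis using that connected_imp_connected_closure[OF E(1)] by blast
qed

text \<open>Points of \<open>Q\<close> near \<open>z\<close> lie over \<open>[-a,a]\<close> and are
  joined to \<open>w\<close> within the strip. The bound \<open>a - 1\<close> leaves room for this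
  approximation.\<close>

lemma closure_component_in_strip:
  fixes Q :: "(real \<times> real) set"
  assumes R: "\<And>z. \<lbrakk>\<bar>fst z\<bar> \<le> a; connected_component (- Y) z w\<rbrakk>
      \<Longrightarrow> connected_component (- Y \<inter> {-R<..<R} \<times> UNIV) z w"
    and Q: "connected Q" "Q \<subseteq> - Y" "w \<in> Q" and z: "z \<in> closure Q" "\<bar>fst z\<bar> \<le> a - 1"
  shows "z \<in> closure (connected_component_set (- Y \<inter> {-R<..<R} \<times> UNIV) w)"
  unfolding closure_approachable
proof (intro allI impI)
  fix e :: real assume "e > 0"
  then obtain y where y: "y \<in> Q" "dist y z < min e 1" using z(1) unfolding closure_approachable
    by (metis min_less_iff_conj zero_less_one)
  then have "\<bar>fst y - fst z\<bar> < 1" using dist_fst_le[of y z] by (simp add: dist_real_def)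
  then have "\<bar>fst y\<bar> \<le> a" using z(2) by linarith
  moreover have "connected_component (- Y) y w" unfolding connected_component_def using Q y by blast
  ultimately have "connected_component (- Y \<inter> {-R<..<R} \<times> UNIV) w y"
    using R connected_component_sym by blast
  then show "\<exists>y\<in>connected_component_set (- Y \<inter> {-R<..<R} \<times> UNIV) w. dist y z < e"
    using y(2) by (intro bexI[of _ y]) simp_all
qed

section \<open>The lifted continuum\<close>

text \<open>The quantitative substitute for finite width of a spike: how far one has to move
  sideways inside \<open>X\<close> to reach \<open>C\<close>. \<open>K\<close> need not be closed;
  closures are taken where required.\<close>

definition tied :: "(real \<times> real) set \<Rightarrow> (real \<times> real) set \<Rightarrow> real \<Rightarrow> real \<times> real \<Rightarrow> bool" where
  "tied X C r x \<longleftrightarrow> (\<exists>K. connected K \<and> x \<in> K \<and> K \<subseteq> X \<and> K \<subseteq> {fst x - r..fst x + r} \<times> UNIV \<and> K \<inter> C \<noteq> {})"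

lemma tied_mono: "tied X C r x \<Longrightarrow> r \<le> r' \<Longrightarrow> tied X C r' x"
proof -
  assume "tied X C r x" "r \<le> r'"
  then obtain K where "connected K" "x \<in> K" "K \<subseteq> X" "K \<subseteq> {fst x - r..fst x + r} \<times> UNIV" "K \<inter> C \<noteq> {}"
    unfolding tied_def by blast
  moreover from \<open>r \<le> r'\<close> have "{fst x - r..fst x + r} \<times> (UNIV :: real set) \<subseteq> {fst x - r'..fst x + r'} \<times> UNIV"
    by auto
  ultimately show ?thesis unfolding tied_def by (meson order_trans)
qed

lemma closed_fst_interval: "closed ({a..b} \<times> UNIV :: (real \<times> real) set)"
  by (intro closed_Times) auto

lemma compact_Int_fst_interval:
  assumes "closed X" "X \<subseteq> UNIV \<times> {-M..M}"
  shows "compact (X \<inter> {a..b::real} \<times> (UNIV :: real set))"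
proof -
  have "X \<inter> {a..b} \<times> UNIV \<subseteq> {a..b} \<times> {-M..M}"
  proof
    fix p assume p: "p \<in> X \<inter> {a..b} \<times> UNIV"
    then have "p \<in> UNIV \<times> {-M..M}" using assms(2) by (meson IntD1 subsetD)
    then show "p \<in> {a..b} \<times> {-M..M}" using p by (simp add: mem_Times_iff)
  qed
  moreover have "closed (X \<inter> {a..b} \<times> UNIV)" using assms(1) closed_fst_interval by (rule closed_Int)
  moreover have "compact ({a..b} \<times> {-M..M})" by (intro compact_Times) auto
  ultimately show ?thesis by (metis compact_Int_closed inf.absorb_iff2)
qed

lemma connected_subset_one_side:
  assumes "connected W" "W \<subseteq> U \<union> V" "open U" "open V" "U \<inter> V = {}" "x \<in> W" "x \<in> U"
  shows "W \<subseteq> U"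
  using connectedD[OF assms(1,3,4)] assms by blast

text \<open>
  The sign \<open>s\<close> records which of \<open>P\<close>, \<open>N\<close> is the upper domain, so that the locale is
  symmetric under exchanging them. The last assumption encodes connectedness of the continuum in
  the annulus; the lift \<open>X\<close> itself is not assumed to be connected.
\<close>

locale thin_annular_lift =
  fixes X P N :: "(real \<times> real) set" and M s :: real
  assumes closed_X: "closed X"
    and inv_X: "p \<in> X \<Longrightarrow> Tpow n p \<in> X"
    and bd_X: "X \<subseteq> UNIV \<times> {-M..M}"
    and open_P: "open P" and open_N: "open N"
    and connected_P: "connected P" and connected_N: "connected N"
    and inv_P: "p \<in> P \<Longrightarrow> Tpow n p \<in> P"
    and inv_N: "p \<in> N \<Longrightarrow> Tpow n p \<in> N"
    and disjoint_PN: "P \<inter> N = {}" and Compl_X: "- X = P \<union> N"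
    and dense_PN: "closure (P \<union> N) = UNIV"
    and sign: "s = 1 \<or> s = - 1"
    and high_P: "s * snd p > M \<Longrightarrow> p \<in> P"
    and low_N: "s * snd p < - M \<Longrightarrow> p \<in> N"
    and indecomposable_X: "\<lbrakk>closed F; closed F'; F \<inter> F' = {}; F \<union> F' = X;
      \<And>n p. p \<in> F \<Longrightarrow> Tpow n p \<in> F; \<And>n p. p \<in> F' \<Longrightarrow> Tpow n p \<in> F'\<rbrakk> \<Longrightarrow> F = {} \<or> F' = {}"
begin

abbreviation "C \<equiv> closure P \<inter> closure N"

text \<open>Makes every result about the side of \<open>P\<close> available for the side of
  \<open>N\<close>.\<close>

lemma swap_sides: "thin_annular_lift X N P M (- s)"
proof
  show "X \<subseteq> UNIV \<times> {-M..M}" by (rule bd_X)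
  show "- s = 1 \<or> - s = - 1" using sign by auto
  show "p \<in> N" if "- s * snd p > M" for p using that low_N[of p] by simp
  show "p \<in> P" if "- s * snd p < - M" for p using that high_P[of p] by simp
qed (use closed_X inv_X open_P open_N connected_P connected_N inv_P inv_N disjoint_PN Compl_X dense_PN
    indecomposable_X in \<open>auto simp: Un_commute\<close>)

lemma closure_N_disjoint: "closure N \<inter> P = {}"
  using open_P disjoint_PN by (metis Int_commute open_Int_closure_eq_empty)

lemma closure_P_disjoint: "closure P \<inter> N = {}"
  using open_N disjoint_PN by (metis Int_commute open_Int_closure_eq_empty)

lemma C_subset: "C \<subseteq> X"
  using closure_N_disjoint closure_P_disjoint Compl_X by blast

lemma closed_C: "closed C"
  by auto

lemma bd_C: "C \<subseteq> UNIV \<times> {-M..M}"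
  using C_subset bd_X by (rule subset_trans)

lemma inv_closure:
  assumes "\<And>n p. p \<in> S \<Longrightarrow> Tpow n p \<in> S" "p \<in> closure S"
  shows "Tpow n p \<in> closure S"
proof -
  have "Tpow n ` closure S \<subseteq> closure S"
    using assms(1) closure_subset by (intro image_closure_subset continuous_on_Tpow closed_closure) blast
  then show ?thesis using assms(2) by blast
qed

lemma inv_closure_N: "p \<in> closure N \<Longrightarrow> Tpow n p \<in> closure N"
  using inv_closure[OF inv_N] by blast

lemma inv_closure_P: "p \<in> closure P \<Longrightarrow> Tpow n p \<in> closure P"
  using inv_closure[OF inv_P] by blast

lemma inv_C: "p \<in> C \<Longrightarrow> Tpow n p \<in> C"
  using inv_closure_N inv_closure_P by blast

lemma closures_cover: "closure P \<union> closure N = UNIV"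
  using dense_PN by simp

lemma top_in_P: "(x, s * (M + 1)) \<in> P" and bottom_in_N: "(x, - s * (M + 1)) \<in> N"
  using sign high_P[of "(x, s * (M + 1))"] low_N[of "(x, - s * (M + 1))"] by auto

text \<open>The plane is connected and cannot be covered by two disjoint nonempty closed
  sets.\<close>

lemma C_nonempty: "C \<noteq> {}"
proof
  assume "C = {}"
  then show False
    using connected_UNIV[where 'a = "real \<times> real"] closures_cover top_in_P bottom_in_N
      closure_subset[of P] closure_subset[of N]
    unfolding connected_closed by (metis Int_UNIV_right closed_closure empty_iff subset_UNIV subset_empty inf_bot_right subsetD)
qed

lemma Compl_C: "- C = (- closure N) \<union> (- closure P)"
  by blast

lemma sides_disjoint: "(- closure N) \<inter> (- closure P) = {}"
  using closures_cover by blast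

lemma open_sides: "open (- closure N)" "open (- closure P)"
  by auto

text \<open>A connected set off \<open>Y\<close> that starts at the end of \<open>P\<close> stays in
  \<open>U\<close>. For \<open>X\<close> the pair \<open>U\<close>, \<open>V\<close> is
  \<open>P\<close>, \<open>N\<close>; for \<open>C\<close> it is the pair of complements of the
  opposite closures.\<close>

lemma separated_if_Compl_subset:
  assumes "- Y \<subseteq> U \<union> V" "open U" "open V" "U \<inter> V = {}" "P \<subseteq> U" "N \<subseteq> V"
  shows "\<not> connected_component (- Y) (0, M + 1) (0, - M - 1)"
proof
  have no: "\<not> connected_component (- Y) (0, s * (M + 1)) (0, - s * (M + 1))"
  proof
    assume "connected_component (- Y) (0, s * (M + 1)) (0, - s * (M + 1))"
    then obtain W where W: "connected W" "W \<subseteq> - Y" "(0, s * (M + 1)) \<in> W" "(0, - s * (M + 1)) \<in> W"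
      unfolding connected_component_def by blast
    have "W \<subseteq> U"
      using connected_subset_one_side[OF W(1) _ assms(2-4) W(3)] W(2) assms(1,5) top_in_P by blast
    then show False using W(4) bottom_in_N assms(4,6) by blast
  qed
  assume cc: "connected_component (- Y) (0, M + 1) (0, - M - 1)"
  from sign show False
  proof
    assume "s = 1"
    then have "(0, s * (M + 1)) = (0::real, M + 1)" "(0, - s * (M + 1)) = (0::real, - M - 1)" by simp_all
    then show False using no cc by metis
  next
    assume "s = - 1"
    then have "(0, s * (M + 1)) = (0::real, - M - 1)" "(0, - s * (M + 1)) = (0::real, M + 1)" by simp_all
    then show False using no cc connected_component_sym by metis
  qed
qed

lemma separated_X: "\<not> connected_component (- X) (0, M + 1) (0, - M - 1)"
  by (rule separated_if_Compl_subset[of _ P N]) (use Compl_X open_P open_N disjoint_PN in auto)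

lemma separated_C: "\<not> connected_component (- C) (0, M + 1) (0, - M - 1)"
  by (rule separated_if_Compl_subset[of _ "- closure N" "- closure P"])
    (use Compl_C open_sides sides_disjoint closure_N_disjoint closure_P_disjoint in blast)+

lemma abs_snd_ends: "\<bar>snd (0::real, s * (M + 1))\<bar> \<ge> M + 1" "\<bar>snd (0::real, - s * (M + 1))\<bar> \<ge> M + 1"
  using sign by auto

section \<open>From a generator of \<open>X\<close> to a generator of \<open>C\<close>\<close>

text \<open>The set is the closure of the strip component that contains the end of \<open>P\<close>.
  The assumption on \<open>R\<close> has the form delivered by
  \<open>translates_component_in_strip\<close>, and \<open>2 \<le> a\<close> pays for the unit lost
  in passing to closures.\<close>

lemma closure_P_strip:
  assumes "2 \<le> a" and R: "\<And>z w. \<lbrakk>\<bar>fst z\<bar> \<le> a; \<bar>fst w\<bar> \<le> a; \<bar>snd w\<bar> \<ge> M + 1;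
    connected_component (- X) z w\<rbrakk> \<Longrightarrow> connected_component (- X \<inter> {-R<..<R} \<times> UNIV) z w"
  obtains W where "connected W" "W \<subseteq> closure P" "W \<subseteq> {-R..R} \<times> UNIV"
    "\<And>z. z \<in> closure P \<Longrightarrow> \<bar>fst z\<bar> \<le> 1 \<Longrightarrow> z \<in> W"
proof -
  let ?w = "(0, s * (M + 1))"
  let ?W = "connected_component_set (- X \<inter> {-R<..<R} \<times> UNIV) ?w"
  have sub: "?W \<subseteq> - X \<inter> {-R<..<R} \<times> UNIV" by (rule connected_component_subset)
  have WP: "?W \<subseteq> P"
  proof (cases "?w \<in> ?W")
    case True
    show ?thesis
      by (rule connected_subset_one_side[OF connected_connected_component _ open_P open_N disjoint_PN True top_in_P])
        (use sub Compl_X in blast)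
  next
    case False
    then have "?W = {}" using connected_component_eq_empty connected_component_refl_eq by (metis mem_Collect_eq)
    then show ?thesis by (metis empty_subsetI)
  qed
  have "closure ?W \<subseteq> {-R..R} \<times> UNIV"
    by (rule closure_minimal[OF _ closed_fst_interval]) (use sub in fastforce)
  moreover have "z \<in> closure ?W" if "z \<in> closure P" "\<bar>fst z\<bar> \<le> 1" for z
  proof (rule closure_component_in_strip[of a])
    show "connected_component (- X \<inter> {-R<..<R} \<times> UNIV) z ?w"
      if "\<bar>fst z\<bar> \<le> a" "connected_component (- X) z ?w" for z
      using R[OF that(1) _ abs_snd_ends(1) that(2)] assms(1) by simp
  qed (use connected_P Compl_X top_in_P that assms(1) in auto)
  moreover have "connected (closure ?W)" by (intro connected_imp_connected_closure connected_connected_component)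
  ultimately show ?thesis using that closure_mono[OF WP] by blast
qed

lemma generated_C:
  assumes G: "compact G" "connected G" "X = translates UNIV G"
  obtains H where "compact H" "connected H" "C = translates UNIV H"
proof -
  have "G \<noteq> {}" using G(3) C_nonempty C_subset unfolding translates_def by blast
  moreover have "connected X" by (rule translates_separating_connected[OF G bd_X separated_X])
  ultimately obtain H where H: "compact H" "connected H" "X = translates UNIV H" "H \<inter> Tpow 1 ` H \<noteq> {}"
    using linked_generator G by metis
  \<comment> \<open>The bound holds for \<open>w\<close> at either end, so one \<open>R\<close>
    serves both \<open>P\<close> and \<open>N\<close>.\<close>
  obtain R where R: "R > 2" "\<And>z w. \<lbrakk>\<bar>fst z\<bar> \<le> 2; \<bar>fst w\<bar> \<le> 2; \<bar>snd w\<bar> \<ge> M + 1;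
    connected_component (- X) z w\<rbrakk> \<Longrightarrow> connected_component (- X \<inter> {-R<..<R} \<times> UNIV) z w"
    using translates_component_in_strip[OF H(1,2,4,3) bd_X separated_X, of 2] by auto
  interpret swapped: thin_annular_lift X N P M "- s" by (rule swap_sides)
  obtain W where W: "connected W" "W \<subseteq> closure P" "W \<subseteq> {-R..R} \<times> UNIV"
    "\<And>z. z \<in> closure P \<Longrightarrow> \<bar>fst z\<bar> \<le> 1 \<Longrightarrow> z \<in> W"
    using closure_P_strip[of 2 R] R(2) by auto
  obtain W' where W': "connected W'" "W' \<subseteq> closure N" "W' \<subseteq> {-R..R} \<times> UNIV"
    "\<And>z. z \<in> closure N \<Longrightarrow> \<bar>fst z\<bar> \<le> 1 \<Longrightarrow> z \<in> W'"
    using swapped.closure_P_strip[of 2 R] R(2) by auto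
  obtain c where "c \<in> C" using C_nonempty by blast
  define x where "x = Tpow (- \<lfloor>fst c\<rfloor>) c"
  have x: "x \<in> C" "\<bar>fst x\<bar> \<le> 1"
    using inv_C[OF \<open>c \<in> C\<close>] unfolding x_def by (simp, simp) linarith
  let ?S = "C \<inter> {-R..R} \<times> UNIV"
  \<comment> \<open>\<open>W\<close> and \<open>W'\<close> join \<open>x\<close> to \<open>y\<close>
    over the strip inside \<open>closure P\<close> and inside \<open>closure N\<close>, as
    unicoherence of the strip requires.\<close>
  have cc: "connected_component ?S x y" if y: "y \<in> C" "\<bar>fst y\<bar> \<le> 1" for y
    using W W' x y closures_cover compact_Int_fst_interval[OF closed_C bd_C]
    by (intro strip_inter_connected_component[of _ _ W _ _ _ W']) auto
  let ?E = "connected_component_set ?S x"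
  have EC: "?E \<subseteq> C" "?E \<subseteq> {-R..R} \<times> UNIV"
    using connected_component_subset[of ?S x] by blast+
  have "C \<inter> {0..1} \<times> UNIV \<subseteq> ?E"
  proof
    fix y assume "y \<in> C \<inter> {0..1} \<times> UNIV"
    then have "y \<in> C" "\<bar>fst y\<bar> \<le> 1" by (auto simp: mem_Times_iff)
    then show "y \<in> ?E" using cc by simp
  qed
  then show ?thesis
    using invariant_generated[OF closed_C inv_C bd_C connected_connected_component EC] that by blast
qed

section \<open>Continua in \<open>X\<close> that reach \<open>C\<close>\<close>

text \<open>A boundary bumping argument in which invariant splittings replace connectedness of
  \<open>X\<close>. If \<open>K\<close> missed both \<open>C\<close> and the walls of its window, so
  would a compact relatively open piece \<open>Q\<close> around it. Its translates and their
  complement in \<open>X\<close> would be an invariant closed splitting with \<open>x\<close> on one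
  side and \<open>C\<close> on the other.\<close>

lemma component_reaches_boundary:
  assumes x: "x \<in> X" and L: "L > 0"
    and K: "K = connected_component_set (X \<inter> {fst x - L..fst x + L} \<times> UNIV) x" and KC: "K \<inter> C = {}"
  obtains y where "y \<in> K" "\<bar>fst y - fst x\<bar> = L"
proof (rule ccontr)
  assume no: "\<not> thesis"
  let ?S = "X \<inter> {fst x - L..fst x + L} \<times> UNIV"
  let ?F = "C \<union> {y. \<bar>fst y - fst x\<bar> = L}"
  have clF: "closed {y :: real \<times> real. \<bar>fst y - fst x\<bar> = L}"
    by (intro closed_Collect_eq continuous_intros)
  have xS: "x \<in> ?S" using x L by (auto simp: mem_Times_iff)
  have KF: "connected_component_set ?S x \<inter> ?F = {}"
    using KC no that unfolding K by blast
  obtain Q where Q: "compact Q" "compact (?S - Q)" "x \<in> Q" "Q \<subseteq> ?S" "Q \<inter> ?F = {}"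
    using compact_component_clopen[OF compact_Int_fst_interval[OF closed_X bd_X] xS
        closed_Un[OF closed_C clF] KF] by blast
  \<comment> \<open>Since \<open>Q\<close> misses the walls, \<open>X - Q\<close> is a union of two
    closed sets: the rest of the window, and everything from the walls outwards.\<close>
  have XQ: "X - Q = (?S - Q) \<union> (X \<inter> {y. \<bar>fst y - fst x\<bar> \<ge> L})"
  proof (intro equalityI subsetI)
    fix p assume "p \<in> X - Q"
    then show "p \<in> (?S - Q) \<union> (X \<inter> {y. \<bar>fst y - fst x\<bar> \<ge> L})"
      by (cases "\<bar>fst p - fst x\<bar> \<ge> L") (auto simp: mem_Times_iff)
  next
    fix p assume p: "p \<in> (?S - Q) \<union> (X \<inter> {y. \<bar>fst y - fst x\<bar> \<ge> L})"
    show "p \<in> X - Q"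
    proof (cases "p \<in> Q")
      case True
      then have "fst p \<in> {fst x - L..fst x + L}" "\<bar>fst p - fst x\<bar> \<noteq> L"
        using Q(4,5) by (auto simp: mem_Times_iff)
      then show ?thesis using p True by auto
    qed (use p in blast)
  qed
  have "closed {y :: real \<times> real. \<bar>fst y - fst x\<bar> \<ge> L}"
    by (intro closed_Collect_le continuous_intros)
  then have clXQ: "closed (X - Q)"
    unfolding XQ using closed_X compact_imp_closed[OF Q(2)] by (intro closed_Un closed_Int)
  \<comment> \<open>\<open>?B\<close> is the complement of \<open>?A\<close> in \<open>X\<close>,
    written as an intersection to show that it is closed.\<close>
  let ?A = "translates UNIV Q" and ?B = "\<Inter>n. Tpow n ` (X - Q)"
  have "?A = {} \<or> ?B = {}"
  proof (rule indecomposable_X)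
    show "closed ?A" using Q(1) by (rule closed_translates)
    show "closed ?B" using clXQ by (auto intro: closed_Tpow_image)
    show "?A \<inter> ?B = {}" unfolding translates_def
    proof (rule equals0I)
      fix p assume "p \<in> (\<Union>n\<in>UNIV. Tpow n ` Q) \<inter> ?B"
      then obtain n where "p \<in> Tpow n ` Q" "p \<in> Tpow n ` (X - Q)" by blast
      then show False by (simp add: Tpow_image_iff)
    qed
    show "?A \<union> ?B = X"
    proof (intro equalityI subsetI)
      fix p assume "p \<in> ?A \<union> ?B"
      then consider "p \<in> ?A" | "p \<in> Tpow 0 ` (X - Q)" by blast
      then show "p \<in> X"
      proof cases
        case 1
        then obtain n q where "q \<in> Q" "p = Tpow n q" unfolding translates_def by blast
        then show ?thesis using Q(4) inv_X by blast
      qed simp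
    next
      fix p assume p: "p \<in> X"
      show "p \<in> ?A \<union> ?B"
      proof (cases "p \<in> ?A")
        case False
        then have "p \<in> Tpow n ` (X - Q)" for n
          using inv_X[OF p, of "- n"] unfolding translates_def by (auto simp: Tpow_image_iff)
        then show ?thesis by blast
      qed simp
    qed
    show "Tpow n p \<in> ?A" if "p \<in> ?A" for n p using that by (rule Tpow_translates_UNIV)
    show "Tpow n p \<in> ?B" if p: "p \<in> ?B" for n p
    proof
      fix k
      have "p \<in> Tpow (k - n) ` (X - Q)" using p by blast
      then show "Tpow n p \<in> Tpow k ` (X - Q)" by (simp add: Tpow_image_iff)
    qed
  qed
  moreover have "x \<in> ?A"
  proof -
    have "x \<in> Tpow 0 ` Q" using Q(3) by simp
    then show ?thesis unfolding translates_def by blast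
  qed
  moreover obtain c where c: "c \<in> C" using C_nonempty by blast
  moreover have "c \<in> ?B"
  proof
    fix n
    have "Tpow (- n) c \<in> C" using inv_C[OF c] .
    then show "c \<in> Tpow n ` (X - Q)"
      using Q(5) C_subset unfolding Tpow_image_iff by blast
  qed
  ultimately show False by blast
qed

text \<open>Being tied survives limits at the cost of one unit. If the component of \<open>x\<close>
  in the wider window missed \<open>C\<close>, a clopen piece \<open>Q\<close> of the window would
  contain \<open>x\<close> and miss \<open>C\<close>; a tie of a nearby point lies in the window,
  starts in \<open>Q\<close>, and could never leave it.\<close>

lemma tied_closure:
  assumes x: "x \<in> X" and cl: "x \<in> closure {y \<in> X. tied X C r y}" and r: "0 \<le> r"
  shows "tied X C (r + 1) x"
proof (rule ccontr)
  let ?I = "{fst x - (r + 1)..fst x + (r + 1)} \<times> (UNIV :: real set)"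
  let ?K = "connected_component_set (X \<inter> ?I) x"
  assume no: "\<not> tied X C (r + 1) x"
  have xS: "x \<in> X \<inter> ?I" using x r by (auto simp: mem_Times_iff)
  have KC: "?K \<inter> C = {}"
  proof (rule ccontr)
    assume "?K \<inter> C \<noteq> {}"
    moreover have "?K \<subseteq> X" "?K \<subseteq> ?I" using connected_component_subset[of "X \<inter> ?I" x] by blast+
    moreover have "x \<in> ?K" using xS by simp
    ultimately show False using no connected_connected_component unfolding tied_def by blast
  qed
  obtain Q where Q: "compact Q" "compact (X \<inter> ?I - Q)" "x \<in> Q" "Q \<subseteq> X \<inter> ?I" "Q \<inter> C = {}"
    using compact_component_clopen[OF compact_Int_fst_interval[OF closed_X bd_X] xS closed_C KC] by blast
  have "open (- (X \<inter> ?I - Q))" using Q(2) compact_imp_closed by blast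
  moreover have "x \<in> - (X \<inter> ?I - Q)" using Q(3) by blast
  ultimately obtain d where d: "d > 0" "ball x d \<subseteq> - (X \<inter> ?I - Q)" by (meson open_contains_ball)
  \<comment> \<open>Distance below \<open>d\<close> puts \<open>y\<close> on the side of
    \<open>Q\<close>; distance below \<open>1\<close> keeps the window of \<open>y\<close> inside
    \<open>?I\<close>.\<close>
  obtain y where y: "y \<in> {y \<in> X. tied X C r y}" "dist y x < min d 1"
    using cl d(1) unfolding closure_approachable by (metis min_less_iff_conj zero_less_one)
  obtain K where K: "connected K" "y \<in> K" "K \<subseteq> X" "K \<subseteq> {fst y - r..fst y + r} \<times> UNIV" "K \<inter> C \<noteq> {}"
    using y(1) unfolding tied_def by blast
  have "\<bar>fst y - fst x\<bar> < 1" using y(2) dist_fst_le[of y x] by (simp add: dist_real_def)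
  then have "{fst y - r..fst y + r} \<times> UNIV \<subseteq> ?I" by auto
  then have KS: "K \<subseteq> Q \<union> (X \<inter> ?I - Q)" using K(3,4) by blast
  have "y \<in> ball x d" using y(2) by (simp add: dist_commute)
  then have "y \<in> Q" using d(2) KS K(2) by blast
  moreover have "Q \<inter> K = {} \<or> (X \<inter> ?I - Q) \<inter> K = {}"
    by (rule connected_closedD[OF K(1) _ KS]) (use Q(1,2) compact_imp_closed in auto)
  ultimately have "(X \<inter> ?I - Q) \<inter> K = {}" using K(2) by blast
  then show False using KS K(5) Q(5) by blast
qed

text \<open>In the window of radius \<open>r + 1\<close>, a component missing \<open>C\<close> would
  reach distance \<open>r + 1\<close> from \<open>x\<close> within \<open>X - C\<close>, beyond the
  bound \<open>r\<close>.\<close>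

lemma tied_if_spike_bounded:
  assumes x: "x \<in> X - C" and r: "0 \<le> r"
    and bnd: "\<And>S y. \<lbrakk>connected S; x \<in> S; S \<subseteq> X - C; y \<in> S\<rbrakk> \<Longrightarrow> \<bar>fst y - fst x\<bar> \<le> r"
  shows "tied X C (r + 1) x"
proof -
  let ?I = "{fst x - (r + 1)..fst x + (r + 1)} \<times> (UNIV :: real set)"
  let ?K = "connected_component_set (X \<inter> ?I) x"
  have xS: "x \<in> X \<inter> ?I" using x r by (auto simp: mem_Times_iff)
  have K: "?K \<subseteq> X" "?K \<subseteq> ?I" using connected_component_subset[of "X \<inter> ?I" x] by blast+
  have xK: "x \<in> ?K" using xS by simp
  have "?K \<inter> C \<noteq> {}"
  proof
    assume KC: "?K \<inter> C = {}"
    have "r + 1 > 0" using r by simp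
    then obtain y where y: "y \<in> ?K" "\<bar>fst y - fst x\<bar> = r + 1"
      using component_reaches_boundary[of x "r + 1" ?K] x KC by blast
    have "?K \<subseteq> X - C" using K(1) KC by blast
    from bnd[OF connected_connected_component xK this y(1)] y(2) show False by simp
  qed
  then show ?thesis unfolding tied_def using K xK connected_connected_component by blast
qed

text \<open>The sets \<open>?F n\<close> exhaust the closed set \<open>?S\<close>, so by Baire the
  closure of one of them has interior in \<open>?S\<close>; \<open>tied_closure\<close> then removes
  the closure and accounts for \<open>Suc n\<close>.\<close>

lemma locally_uniformly_tied:
  assumes x1: "x1 \<in> X - closure N" and fin: "\<And>x. x \<in> X - C \<Longrightarrow> \<exists>r. tied X C r x"
  obtains x0 e n where "x0 \<in> X" "e > 0" "cball x0 e \<subseteq> - closure N"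
    "\<And>y. y \<in> X \<inter> cball x0 e \<Longrightarrow> tied X C (real n) y"
proof -
  obtain d where d: "d > 0" "cball x1 d \<subseteq> - closure N"
    using x1 open_sides(1) by (metis Compl_iff DiffD2 open_contains_cball)
  let ?S = "closure (X \<inter> ball x1 d)"
  let ?F = "\<lambda>n::nat. {y \<in> X. tied X C (real n) y}"
  have S: "?S \<subseteq> X" "?S \<subseteq> cball x1 d"
    by (rule closure_minimal; use closed_X in force)+
  have "x1 \<in> ?S" using x1 d(1) closure_subset[of "X \<inter> ball x1 d"] by auto
  have "\<exists>n. \<not> ?S \<subseteq> closure (?S - closure (?F n))"
  proof (rule ccontr)
    assume "\<not> (\<exists>n. \<not> ?S \<subseteq> closure (?S - closure (?F n)))"
    then have dense: "?S \<subseteq> closure (?S - closure (?F n))" for n by blast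
    have "?S \<subseteq> closure (\<Inter>(range (\<lambda>n. ?S - closure (?F n))))"
    proof (rule Baire)
      fix T assume "T \<in> range (\<lambda>n. ?S - closure (?F n))"
      then obtain n where n: "T = ?S - closure (?F n)" by blast
      have "openin (top_of_set ?S) (?S \<inter> - closure (?F n))"
        by (intro openin_open_Int) auto
      then show "openin (top_of_set ?S) T \<and> ?S \<subseteq> closure T"
        using dense[of n] unfolding n by (simp add: Diff_eq)
    qed auto
    moreover have "\<Inter>(range (\<lambda>n. ?S - closure (?F n))) = {}"
    proof (rule equals0I)
      fix y assume y: "y \<in> \<Inter>(range (\<lambda>n. ?S - closure (?F n)))"
      then have "y \<in> ?S" by blast
      then have "y \<in> X - C" using S d(2) by blast
      then obtain r where r: "tied X C r y" using fin by blast
      obtain n :: nat where "r \<le> real n" using real_arch_simple by blast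
      then have "y \<in> ?F n" using tied_mono[OF r] \<open>y \<in> X - C\<close> by blast
      then have "y \<in> closure (?F n)" by (rule subsetD[OF closure_subset])
      moreover have "y \<in> ?S - closure (?F n)" using y by (rule INT_D[OF _ UNIV_I])
      ultimately show False by blast
    qed
    ultimately have "?S \<subseteq> closure {}" by (simp only:)
    then show False using \<open>x1 \<in> ?S\<close> by auto
  qed
  then obtain n z where z: "z \<in> ?S" "z \<notin> closure (?S - closure (?F n))" by blast
  \<comment> \<open>\<open>X \<inter> ball x1 d\<close> is dense in \<open>?S\<close>, so the
    nonempty relatively open set just found contains one of its points, which becomes the centre
    \<open>x0\<close>.\<close>
  have op: "open (- closure (?S - closure (?F n)))" by auto
  have "- closure (?S - closure (?F n)) \<inter> ?S \<noteq> {}" using z by blast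
  then have "- closure (?S - closure (?F n)) \<inter> (X \<inter> ball x1 d) \<noteq> {}"
    by (simp only: open_Int_closure_eq_empty[OF op] simp_thms)
  then obtain x0 where x0: "x0 \<in> X" "x0 \<in> ball x1 d" "x0 \<in> - closure (?S - closure (?F n))" by blast
  have "open (ball x1 d \<inter> - closure (?S - closure (?F n)))" by auto
  then obtain e where e: "e > 0" "cball x0 e \<subseteq> ball x1 d \<inter> - closure (?S - closure (?F n))"
    using x0 by (meson IntI open_contains_cball)
  have "tied X C (real (Suc n)) y" if y: "y \<in> X \<inter> cball x0 e" for y
  proof -
    have "y \<in> X \<inter> ball x1 d" using y e(2) by blast
    then have "y \<in> ?S" using closure_subset by blast
    moreover have "y \<notin> ?S - closure (?F n)" using y e(2) closure_subset by blast
    ultimately have "y \<in> closure (?F n)" by blast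
    then have "tied X C (real n + 1) y" using y by (intro tied_closure) auto
    then show ?thesis by (simp add: add.commute)
  qed
  moreover have "cball x0 e \<subseteq> - closure N" using e(2) d(2) ball_subset_cball by blast
  ultimately show ?thesis using that x0(1) e(1) by blast
qed

section \<open>From local to uniform bounds by crossing a post\<close>

text \<open>The path \<open>g\<close> runs in \<open>P\<close> and the far end lies in
  \<open>closure N\<close>, so a point of the post in \<open>X\<close> and off
  \<open>closure N\<close> is in the ball or in \<open>K1\<close>. The former points are tied by the
  choice of the ball, and for the latter \<open>K1\<close> itself, which contains \<open>c\<close>,
  is the tie.\<close>

lemma crossing_post:
  assumes x1: "x1 \<in> X - closure N" and fin: "\<And>x. x \<in> X - C \<Longrightarrow> \<exists>r. tied X C r x"
    and G: "compact G" "connected G" "C = translates UNIV G"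
  obtains V and m :: nat where "closed V" "connected V" "V \<subseteq> {- real m..real m} \<times> UNIV"
    "(0, s * (M + 1)) \<in> V" "(0, - s * (M + 1)) \<in> V"
    "\<And>v. v \<in> V \<inter> X - closure N \<Longrightarrow>
      \<exists>K. connected K \<and> v \<in> K \<and> K \<subseteq> X \<and> K \<subseteq> {- real m..real m} \<times> UNIV \<and> K \<inter> C \<noteq> {}"
proof -
  obtain x0 e n where x0: "x0 \<in> X" "e > 0" "cball x0 e \<subseteq> - closure N"
    "\<And>y. y \<in> X \<inter> cball x0 e \<Longrightarrow> tied X C (real n) y"
    using locally_uniformly_tied[OF x1 fin] by blast
  have "tied X C (real n) x0" using x0(1,2) by (intro x0(4)) simp
  then obtain K0 where K0: "connected K0" "x0 \<in> K0" "K0 \<subseteq> X"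
    "K0 \<subseteq> {fst x0 - real n..fst x0 + real n} \<times> UNIV" "K0 \<inter> C \<noteq> {}"
    unfolding tied_def by blast
  \<comment> \<open>Closing up the tie makes the post closed; \<open>X\<close> and the window are
    closed, so nothing is lost.\<close>
  define K1 where "K1 = closure K0"
  have K1: "connected K1" "x0 \<in> K1" "K1 \<subseteq> X" "K1 \<subseteq> {fst x0 - real n..fst x0 + real n} \<times> UNIV" "closed K1"
    unfolding K1_def
    using connected_imp_connected_closure[OF K0(1)] subsetD[OF closure_subset K0(2)]
      closure_minimal[OF K0(3) closed_X] closure_minimal[OF K0(4) closed_fst_interval] closed_closure
    by blast+
  obtain c where c: "c \<in> K1" "c \<in> C" using K0(5) closure_subset unfolding K1_def by blast
  \<comment> \<open>Thinness enters here: a ball that misses \<open>closure N\<close> must contain a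
    point of \<open>P\<close>, where the path to the end starts.\<close>
  have "ball x0 e \<inter> (P \<union> N) \<noteq> {}"
    using dense_PN x0(2) by (metis UNIV_I centre_in_ball closure_iff_nhds_not_empty open_ball subset_refl Int_commute)
  then obtain z where z: "z \<in> ball x0 e" "z \<in> P \<union> N" by blast
  have "z \<notin> N" using z(1) x0(3) closure_subset[of N] ball_subset_cball[of x0 e] by blast
  then have "z \<in> P" using z(2) by blast
  have "path_connected P" using connected_open_path_connected open_P connected_P by blast
  then obtain g where g: "path g" "path_image g \<subseteq> P" "pathstart g = z" "pathfinish g = (0, s * (M + 1))"
    using \<open>z \<in> P\<close> top_in_P unfolding path_connected_def by blast
  have "G \<noteq> {}" using G(3) C_nonempty unfolding translates_def by blast
  moreover have "connected C" by (rule translates_separating_connected[OF G bd_C separated_C])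
  ultimately obtain H where H: "compact H" "connected H" "C = translates UNIV H" "H \<inter> Tpow 1 ` H \<noteq> {}"
    using linked_generator[OF G(1,2) _ G(3)] by blast
  \<comment> \<open>The extra unit lets \<open>closure_component_in_strip\<close> apply to
    \<open>c\<close>, which is a limit of points of \<open>N\<close>.\<close>
  define a where "a = \<bar>fst c\<bar> + 1"
  have "0 \<le> a" by (simp add: a_def)
  then obtain R where R: "R > a" "\<And>z w. \<lbrakk>\<bar>fst z\<bar> \<le> a; \<bar>fst w\<bar> \<le> a; \<bar>snd w\<bar> \<ge> M + 1;
    connected_component (- C) z w\<rbrakk> \<Longrightarrow> connected_component (- C \<inter> {-R<..<R} \<times> UNIV) z w"
    using translates_component_in_strip[OF H(1,2,4,3) bd_C separated_C, of a] by blast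
  let ?b = "(0, - s * (M + 1))"
  \<comment> \<open>The far end of the post: the component of the end of \<open>N\<close>, off
    \<open>C\<close> and within the strip. It stays off \<open>closure P\<close>, and its closure is
    attached to \<open>K1\<close> at \<open>c\<close>.\<close>
  let ?W = "connected_component_set (- C \<inter> {-R<..<R} \<times> UNIV) ?b"
  have NC: "N \<subseteq> - C" using closure_P_disjoint by blast
  have bW: "?b \<in> ?W"
  proof -
    have "?b \<in> - C" using bottom_in_N NC by blast
    then show ?thesis using R(1) \<open>0 \<le> a\<close> by simp
  qed
  have Wsub: "?W \<subseteq> - C" "?W \<subseteq> {-R<..<R} \<times> UNIV"
    using connected_component_subset[of "- C \<inter> {-R<..<R} \<times> UNIV" ?b] by blast+
  have WD: "?W \<subseteq> - closure P"
  proof (rule connected_subset_one_side[OF connected_connected_component _ open_sides(2,1) _ bW])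
    show "?W \<subseteq> - closure P \<union> - closure N" using Wsub(1) by blast
    show "- closure P \<inter> - closure N = {}" using sides_disjoint by blast
    show "?b \<in> - closure P" using bottom_in_N closure_P_disjoint by blast
  qed
  have cW: "c \<in> closure ?W"
  proof (rule closure_component_in_strip[of a _ _ _ N])
    show "connected_component (- C \<inter> {-R<..<R} \<times> UNIV) z ?b"
      if "\<bar>fst z\<bar> \<le> a" "connected_component (- C) z ?b" for z
      using R(2)[OF that(1) _ abs_snd_ends(2) that(2)] \<open>0 \<le> a\<close> by simp
  qed (use connected_N NC bottom_in_N c in \<open>auto simp: a_def\<close>)
  have WclN: "closure ?W \<subseteq> closure N"
  proof -
    have "?W \<inter> - closure N = {}" using WD sides_disjoint by blast
    then have "- closure N \<inter> closure ?W = {}" using open_sides(1) by (metis Int_commute open_Int_closure_eq_empty)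
    then show ?thesis by blast
  qed
  have WR: "closure ?W \<subseteq> {-R..R} \<times> UNIV"
    by (rule closure_minimal[OF _ closed_fst_interval]) (use Wsub(2) in fastforce)
  define V where "V = (path_image g \<union> cball x0 e) \<union> (K1 \<union> closure ?W)"
  have "closed V"
    unfolding V_def using g(1) K1(5) by (intro closed_Un closed_path_image closed_cball closed_closure)
  moreover have "connected V" unfolding V_def
  proof (intro connected_Un)
    show "path_image g \<inter> cball x0 e \<noteq> {}"
      using pathstart_in_path_image[of g] g(3) z(1) ball_subset_cball[of x0 e] by blast
    show "K1 \<inter> closure ?W \<noteq> {}" using c(1) cW by blast
    show "(path_image g \<union> cball x0 e) \<inter> (K1 \<union> closure ?W) \<noteq> {}"
      using K1(2) x0(2) by (metis IntI UnCI centre_in_cball empty_iff less_imp_le)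
  qed (use g(1) K1(1) in \<open>auto intro: connected_path_image connected_imp_connected_closure connected_connected_component convex_connected\<close>)
  moreover have "(0, s * (M + 1)) \<in> V"
    using pathfinish_in_path_image[of g] unfolding V_def g(4) by (intro UnI1)
  moreover have "?b \<in> V"
    using subsetD[OF closure_subset bW] unfolding V_def by (intro UnI2)
  moreover obtain m :: nat where m: "V \<subseteq> {- real m..real m} \<times> UNIV" "\<bar>fst x0\<bar> + e + real n \<le> real m"
  proof -
    have "bounded (fst ` (path_image g))" using g(1) compact_path_image compact_imp_bounded bounded_fst by blast
    then obtain B where B: "\<And>p. p \<in> path_image g \<Longrightarrow> \<bar>fst p\<bar> \<le> B" unfolding bounded_iff by auto
    \<comment> \<open>\<open>B\<close> and \<open>R\<close> bound the path and the far end; the last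
      term bounds the ball, \<open>K1\<close>, and the ties of all points of \<open>X\<close> in the
      ball.\<close>
    obtain m :: nat where m: "max (max B R) (\<bar>fst x0\<bar> + e + real n) \<le> real m" using real_arch_simple by blast
    have "V \<subseteq> {- real m..real m} \<times> UNIV"
    proof
      fix v assume "v \<in> V"
      then consider "v \<in> path_image g" | "v \<in> cball x0 e" | "v \<in> K1" | "v \<in> closure ?W"
        unfolding V_def by blast
      then have "\<bar>fst v\<bar> \<le> real m"
      proof cases
        case 1
        then show ?thesis using B m by fastforce
      next
        case 2
        then have "\<bar>fst x0 - fst v\<bar> \<le> e" using dist_fst_le[of x0 v] by (simp add: dist_real_def)
        then show ?thesis using m by auto
      next
        case 3
        then have "v \<in> {fst x0 - real n..fst x0 + real n} \<times> UNIV" by (rule subsetD[OF K1(4)])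
        then have "fst v \<in> {fst x0 - real n..fst x0 + real n}" by (simp only: mem_Times_iff)
        then show ?thesis using m x0(2) by auto
      next
        case 4
        then have "v \<in> {-R..R} \<times> UNIV" by (rule subsetD[OF WR])
        then have "fst v \<in> {-R..R}" by (simp only: mem_Times_iff)
        then show ?thesis using m by auto
      qed
      then show "v \<in> {- real m..real m} \<times> UNIV" by (auto simp: mem_Times_iff)
    qed
    then show thesis using that m by auto
  qed
  moreover have "\<exists>K. connected K \<and> v \<in> K \<and> K \<subseteq> X \<and> K \<subseteq> {- real m..real m} \<times> UNIV \<and> K \<inter> C \<noteq> {}"
    if v: "v \<in> V \<inter> X - closure N" for v
  proof -
    have "v \<notin> path_image g" using v g(2) Compl_X by blast
    moreover have "v \<notin> closure ?W" using v WclN by blast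
    ultimately consider "v \<in> cball x0 e" | "v \<in> K1" using v unfolding V_def by blast
    then show ?thesis
    proof cases
      case 1
      then have "tied X C (real n) v" using x0(4) v by blast
      then obtain K where K: "connected K" "v \<in> K" "K \<subseteq> X" "K \<subseteq> {fst v - real n..fst v + real n} \<times> UNIV" "K \<inter> C \<noteq> {}"
        unfolding tied_def by blast
      have "\<bar>fst x0 - fst v\<bar> \<le> e" using 1 dist_fst_le[of x0 v] by (simp add: dist_real_def)
      then have "{fst v - real n..fst v + real n} \<subseteq> {- real m..real m}" using m(2) by auto
      then have "K \<subseteq> {- real m..real m} \<times> UNIV" using K(4) by (meson Sigma_mono order_trans subset_UNIV subset_refl)
      then show ?thesis using K by blast
    next
      case 2
      moreover have "K1 \<subseteq> V" unfolding V_def by blast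
      ultimately show ?thesis using K1 c m(1) by blast
    qed
  qed
  ultimately show ?thesis using that[of V m] by blast
qed

text \<open>A component of the window of radius \<open>L\<close> that missed \<open>C\<close> would
  reach a wall and so cross some integer translate of the post. The tie at the crossing point lies
  in the same window and leads the component to \<open>C\<close> after all.\<close>

lemma uniformly_tied:
  assumes fin: "\<And>x. x \<in> X - C \<Longrightarrow> \<exists>r. tied X C r x"
    and G: "compact G" "connected G" "C = translates UNIV G"
  shows "\<exists>L. \<forall>x \<in> X - closure N. tied X C L x"
proof (cases "X - closure N = {}")
  case False
  then obtain x1 where "x1 \<in> X - closure N" by blast
  then obtain V and m :: nat where V: "closed V" "connected V" "V \<subseteq> {- real m..real m} \<times> UNIV"
    "(0, s * (M + 1)) \<in> V" "(0, - s * (M + 1)) \<in> V"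
    "\<And>v. v \<in> V \<inter> X - closure N \<Longrightarrow>
      \<exists>K. connected K \<and> v \<in> K \<and> K \<subseteq> X \<and> K \<subseteq> {- real m..real m} \<times> UNIV \<and> K \<inter> C \<noteq> {}"
    using crossing_post[OF _ fin G] by blast
  \<comment> \<open>The width \<open>2 * real m\<close> of the post, with room for rounding its
    position to an integer and for strict inequalities.\<close>
  define L where "L = 2 * real m + 3"
  have "tied X C L x" if x: "x \<in> X - closure N" for x
  proof (rule ccontr)
    let ?S = "X \<inter> {fst x - L..fst x + L} \<times> UNIV"
    let ?K = "connected_component_set ?S x"
    assume no: "\<not> tied X C L x"
    have L0: "L > 0" by (simp add: L_def)
    have xS: "x \<in> ?S" using x L0 by (auto simp: mem_Times_iff)
    have K: "?K \<subseteq> X" "?K \<subseteq> {fst x - L..fst x + L} \<times> UNIV"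
      using connected_component_subset[of ?S x] by blast+
    have xK: "x \<in> ?K" using xS by simp
    have KC: "?K \<inter> C = {}"
      using no K xK connected_connected_component unfolding tied_def by blast
    obtain y where y: "y \<in> ?K" "\<bar>fst y - fst x\<bar> = L"
      using component_reaches_boundary[OF _ L0 refl KC] x by blast
    \<comment> \<open>Off \<open>C\<close> a connected set stays on one side, here away from
      \<open>closure N\<close>, where the post provides ties.\<close>
    have KD: "?K \<subseteq> - closure N"
      by (rule connected_subset_one_side[OF connected_connected_component _ open_sides sides_disjoint xK])
        (use KC x in auto)
    \<comment> \<open>\<open>p\<close> and \<open>q\<close> are \<open>x\<close> and
      \<open>y\<close> ordered from left to right, and \<open>j\<close> shifts the post strictly
      between them.\<close>
    obtain j p q where j: "p \<in> ?K" "q \<in> ?K" "fst p < of_int j - real m" "fst q > of_int j + real m"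
      "fst x - L \<le> of_int j - real m" "of_int j + real m \<le> fst x + L"
    proof (cases "fst y = fst x + L")
      case True
      define j where "j = \<lceil>fst x\<rceil> + int m + 1"
      have "fst x \<le> of_int \<lceil>fst x\<rceil>" "of_int \<lceil>fst x\<rceil> < fst x + 1" by linarith+
      moreover have "real_of_int j = of_int \<lceil>fst x\<rceil> + real m + 1" by (simp add: j_def)
      ultimately show thesis by (intro that[OF xK y(1), of j]; use True L_def in linarith)
    next
      case False
      then have "fst y = fst x - L" using y(2) by auto
      define j where "j = \<lfloor>fst x\<rfloor> - int m - 1"
      have "of_int \<lfloor>fst x\<rfloor> \<le> fst x" "fst x < of_int \<lfloor>fst x\<rfloor> + 1" by linarith+
      moreover have "real_of_int j = of_int \<lfloor>fst x\<rfloor> - real m - 1" by (simp add: j_def)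
      ultimately show thesis by (intro that[OF y(1) xK, of j]; use \<open>fst y = fst x - L\<close> L_def in linarith)
    qed
    let ?K' = "Tpow (- j) ` ?K"
    have cK: "compact ?K"
    proof -
      have "compact ?S" by (rule compact_Int_fst_interval[OF closed_X bd_X])
      then show ?thesis using closed_connected_component[OF compact_imp_closed] connected_component_subset
        by (metis compact_Int_closed inf.absorb_iff2)
    qed
    have K'X: "?K' \<subseteq> X" using K(1) inv_X by blast
    obtain t b where tb: "t \<in> V" "snd t \<ge> M + 1" "b \<in> V" "snd b \<le> - M - 1"
    proof -
      from sign show thesis
      proof
        assume "s = 1"
        then show thesis using that[OF V(4) _ V(5)] by simp
      next
        assume "s = - 1"
        then show thesis using that[OF V(5) _ V(4)] by simp
      qed
    qed
    have "?K' \<inter> V \<noteq> {}"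
    proof (rule crossing_continua_meet[OF V(1-3) tb])
      show "compact ?K'" "connected ?K'"
        using cK by (auto intro: compact_Tpow_image connected_Tpow_image connected_connected_component)
      show "?K' \<subseteq> UNIV \<times> {-M..M}" using K'X bd_X by (rule subset_trans)
      show "Tpow (- j) p \<in> ?K'" "Tpow (- j) q \<in> ?K'" using j by blast+
      show "fst (Tpow (- j) p) < - real m" "fst (Tpow (- j) q) > real m" using j by simp_all
    qed
    then obtain v where v: "v \<in> ?K'" "v \<in> V" by blast
    then have vK: "Tpow j v \<in> ?K" by (simp add: Tpow_image_iff del: mem_Collect_eq)
    then have "v \<notin> closure N" using KD inv_closure_N by blast
    then obtain Kv where Kv: "connected Kv" "v \<in> Kv" "Kv \<subseteq> X" "Kv \<subseteq> {- real m..real m} \<times> UNIV" "Kv \<inter> C \<noteq> {}"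
      using V(6)[of v] v K'X by blast
    have sub: "Tpow j ` Kv \<subseteq> ?S"
    proof
      fix u assume "u \<in> Tpow j ` Kv"
      then obtain w where w: "w \<in> Kv" "u = Tpow j w" by blast
      then have "u \<in> X" using Kv(3) inv_X by blast
      moreover have "fst w \<in> {- real m..real m}" using w(1) Kv(4) by (metis mem_Times_iff subsetD)
      ultimately show "u \<in> ?S" using j(5,6) w(2) by (simp add: mem_Times_iff)
    qed
    have "Tpow j ` Kv \<subseteq> connected_component_set ?S (Tpow j v)"
      by (rule connected_component_maximal) (use Kv sub connected_Tpow_image in auto)
    also have "\<dots> = ?K" using vK connected_component_eq by metis
    finally have "Tpow j ` Kv \<subseteq> ?K" .
    moreover obtain c where "c \<in> Kv" "c \<in> C" using Kv(5) by blast
    moreover have "Tpow j c \<in> C" using inv_C[OF \<open>c \<in> C\<close>] .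
    ultimately show False using KC by blast
  qed
  then show ?thesis by blast
qed blast

text \<open>A long chain \<open>E\<close> of translates of a generator of \<open>C\<close> contains
  all points of \<open>C\<close> at which ties of points over \<open>[0,1]\<close> can end, so
  \<open>E\<close> and these ties lie in one connected set of bounded width.\<close>

lemma generated_X:
  assumes fin: "\<And>x. x \<in> X - C \<Longrightarrow> \<exists>r. tied X C r x"
    and G: "compact G" "connected G" "C = translates UNIV G"
  obtains H where "compact H" "connected H" "X = translates UNIV H"
proof -
  interpret swapped: thin_annular_lift X N P M "- s" by (rule swap_sides)
  obtain L1 where L1: "\<And>x. x \<in> X - closure N \<Longrightarrow> tied X C L1 x" using uniformly_tied[OF fin G] by blast
  have "\<exists>L. \<forall>x \<in> X - closure P. tied X (closure N \<inter> closure P) L x"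
    by (rule swapped.uniformly_tied[of G]) (use fin G in \<open>simp_all add: Int_commute\<close>)
  then obtain L2 where L2: "\<And>x. x \<in> X - closure P \<Longrightarrow> tied X C L2 x" by (auto simp: Int_commute)
  \<comment> \<open>A point of \<open>X - C\<close> misses \<open>closure N\<close> or
    \<open>closure P\<close>, so one of the two bounds applies. The \<open>0\<close> makes
    \<open>E\<close> contain the points of \<open>C\<close> over \<open>[0,1]\<close> as
    well.\<close>
  define L where "L = max 0 (max L1 L2)"
  have L: "tied X C L x" if "x \<in> X - C" for x
    using L1[of x] L2[of x] that tied_mono[of X C _ x L] unfolding L_def by fastforce
  have "G \<noteq> {}" using G(3) C_nonempty unfolding translates_def by blast
  moreover have "connected C" by (rule translates_separating_connected[OF G bd_C separated_C])
  ultimately obtain H where H: "compact H" "connected H" "C = translates UNIV H" "H \<inter> Tpow 1 ` H \<noteq> {}"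
    using linked_generator[OF G(1,2) _ G(3)] by blast
  have "bounded (fst ` H)" using H(1) compact_imp_bounded bounded_fst by blast
  then obtain h where h: "\<And>p. p \<in> H \<Longrightarrow> \<bar>fst p\<bar> \<le> h" unfolding bounded_iff by auto
  \<comment> \<open>A translate with a point over \<open>[-(L+1), L+1]\<close> has index at most
    \<open>L + 1 + h\<close> in absolute value.\<close>
  define q where "q = \<lceil>L + 1 + h\<rceil>"
  define E where "E = translates {-q..q} H"
  have E: "connected E" "E \<subseteq> C"
    unfolding E_def using connected_translates_atLeastAtMost[OF H(2,4)] H(3)
    by (auto simp: translates_def simp del: split_paired_All)
  have CE: "c \<in> E" if c: "c \<in> C" "\<bar>fst c\<bar> \<le> L + 1" for c
  proof -
    obtain n p where n: "p \<in> H" "c = Tpow n p" using c(1) H(3) unfolding translates_def by blast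
    then have "\<bar>real_of_int n\<bar> \<le> L + 1 + h" using c(2) h[OF n(1)] by simp
    then have "n \<in> {-q..q}" unfolding q_def by simp linarith
    then show ?thesis using n unfolding E_def translates_def by blast
  qed
  obtain c0 where c0: "c0 \<in> E"
  proof -
    obtain c where "c \<in> C" using C_nonempty by blast
    then have "Tpow (- \<lfloor>fst c\<rfloor>) c \<in> C" by (rule inv_C)
    moreover have "\<bar>fst (Tpow (- \<lfloor>fst c\<rfloor>) c)\<bar> \<le> L + 1" unfolding L_def by simp linarith
    ultimately show thesis using that CE by blast
  qed
  have "bounded (fst ` E)"
    unfolding E_def using compact_translates[OF H(1), of "{-q..q}"] compact_imp_bounded bounded_fst by blast
  then obtain B where B: "\<And>p. p \<in> E \<Longrightarrow> \<bar>fst p\<bar> \<le> B" unfolding bounded_iff by auto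
  define R where "R = max B (L + 1)"
  let ?S = "X \<inter> {-R..R} \<times> UNIV"
  let ?Z = "connected_component_set ?S c0"
  have ES: "E \<subseteq> ?S"
  proof
    fix p assume p: "p \<in> E"
    then have "\<bar>fst p\<bar> \<le> R" using B unfolding R_def by fastforce
    then show "p \<in> ?S" using p E(2) C_subset by (auto simp: mem_Times_iff)
  qed
  have "X \<inter> {0..1} \<times> UNIV \<subseteq> ?Z"
  proof
    fix x assume x: "x \<in> X \<inter> {0..1} \<times> UNIV"
    then have fx: "0 \<le> fst x" "fst x \<le> 1" by (auto simp: mem_Times_iff)
    obtain K where K: "connected K" "x \<in> K" "K \<subseteq> ?S" "K \<inter> E \<noteq> {}"
    proof (cases "x \<in> C")
      case True
      have "L \<ge> 0" by (simp add: L_def)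
      then have "x \<in> E" using CE[OF True] fx by auto
      then show thesis using that[of "{x}"] ES by auto
    next
      case False
      then obtain K where K: "connected K" "x \<in> K" "K \<subseteq> X" "K \<subseteq> {fst x - L..fst x + L} \<times> UNIV" "K \<inter> C \<noteq> {}"
        using L[of x] x unfolding tied_def by blast
      have fK: "\<bar>fst p\<bar> \<le> L + 1" if "p \<in> K" for p
      proof -
        have "fst p \<in> {fst x - L..fst x + L}" using that K(4) by (metis mem_Times_iff subsetD)
        then show ?thesis using fx by auto
      qed
      have "K \<subseteq> ?S"
      proof
        fix p assume p: "p \<in> K"
        then have "\<bar>fst p\<bar> \<le> R" using fK unfolding R_def by fastforce
        then show "p \<in> ?S" using p K(3) by (auto simp: mem_Times_iff)
      qed
      moreover have "K \<inter> E \<noteq> {}" using K(5) CE fK by blast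
      ultimately show thesis using that K by blast
    qed
    have "connected (K \<union> E)" using connected_Un[OF K(1) E(1) K(4)] .
    then have "K \<union> E \<subseteq> ?Z" using c0 K(3) ES by (intro connected_component_maximal) auto
    then show "x \<in> ?Z" using K(2) by blast
  qed
  moreover have "?Z \<subseteq> X" "?Z \<subseteq> {-R..R} \<times> UNIV"
    using connected_component_subset[of ?S c0] by blast+
  ultimately show ?thesis
    using invariant_generated[OF closed_X inv_X bd_X connected_connected_component] that by blast
qed

end

section \<open>The covering of the annulus\<close>

lemma proj_in_Ann: "proj p \<in> Ann"
  by (simp add: proj_def Ann_def)

lemma continuous_on_proj: "continuous_on S proj"
  unfolding proj_def by (intro continuous_intros)

lemma snd_proj [simp]: "snd (proj p) = snd p"
  by (simp add: proj_def)

lemma proj_Tpow [simp]: "proj (Tpow n p) = proj p"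
proof -
  have "cis (2 * pi * (fst p + of_int n)) = cis (2 * pi * fst p) * cis (2 * pi * of_int n)"
    unfolding cis_mult by (simp only: distrib_left)
  moreover have "cis (2 * pi * of_int n) = 1" by (simp add: cis_multiple_2pi)
  ultimately show ?thesis by (simp add: proj_def)
qed

lemma proj_eq_imp_Tpow:
  assumes "proj p = proj q"
  obtains n where "q = Tpow n p"
proof -
  have "cis (2 * pi * fst q) = cis (2 * pi * fst p)" and s: "snd q = snd p"
    using assms by (simp_all add: proj_def)
  then have "cos (2 * pi * fst q) = cos (2 * pi * fst p)" "sin (2 * pi * fst q) = sin (2 * pi * fst p)"
    by (simp_all add: complex_eq_iff)
  then obtain n where "2 * pi * fst q = 2 * pi * fst p + 2 * pi * of_int n"
    using sin_cos_eq_iff by (metis mult.commute mult.left_commute)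
  then have "2 * pi * fst q = 2 * pi * (fst p + of_int n)" by (simp add: distrib_left)
  then have "fst q = fst p + of_int n" by simp
  then show ?thesis using that[of n] s by (simp add: Tpow_def prod_eq_iff)
qed

text \<open>Near each image point \<open>proj\<close> has a continuous local section.\<close>

lemma proj_open_map:
  assumes "open W"
  shows "openin (top_of_set Ann) (proj ` W)"
  unfolding openin_contains_ball
proof (intro conjI ballI)
  show "proj ` W \<subseteq> Ann" using proj_in_Ann by blast
  fix w assume "w \<in> proj ` W"
  then obtain p where p: "p \<in> W" "w = proj p" by blast
  define u where "u = cis (2 * pi * fst p)"
  \<comment> \<open>Division by \<open>u\<close> moves the base point to \<open>1\<close>, away from
    the branch cut of \<open>Arg\<close>.\<close>
  define g where "g = (\<lambda>z::complex \<times> real. (fst p + Arg (fst z / u) / (2 * pi), snd z))"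
  have u0: "u \<noteq> 0" "norm u = 1" by (auto simp: u_def)
  have w: "w = (u, snd p)" using p(2) by (simp add: proj_def u_def)
  have gw: "g w = p" using u0 by (simp add: g_def w Arg_1)
  have "isCont (\<lambda>z. Arg (fst z / u)) w"
  proof -
    have "isCont (\<lambda>z::complex \<times> real. fst z / u) w" using u0 by (intro continuous_intros)
    moreover have "isCont Arg (fst w / u)" using u0 by (intro continuous_at_Arg) (simp add: w)
    ultimately show ?thesis by (rule isCont_o2)
  qed
  then have "isCont g w" unfolding g_def by (intro continuous_intros) auto
  then have "\<forall>\<^sub>F z in nhds w. g z \<in> W"
    using assms p(1) gw unfolding isCont_def by (metis tendsto_at_iff_tendsto_nhds topological_tendstoD)
  then obtain d where d: "d > 0" "\<And>z. dist z w < d \<Longrightarrow> g z \<in> W" unfolding eventually_nhds_metric by blast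
  have "z \<in> proj ` W" if z: "z \<in> ball w d \<inter> Ann" for z
  proof -
    have "norm (fst z) = 1" using z by (auto simp: Ann_def)
    then have n1: "norm (fst z / u) = 1" using u0 by (simp add: norm_divide)
    then have "fst z / u = cis (Arg (fst z / u))"
      using cis_Arg[of "fst z / u"] by (metis norm_zero sgn_div_norm zero_neq_one inverse_1 scaleR_one)
    moreover have "cis (2 * pi * fst (g z)) = u * cis (Arg (fst z / u))"
      by (simp add: g_def u_def cis_mult distrib_left)
    ultimately have "cis (2 * pi * fst (g z)) = fst z" using u0 by simp
    then have "proj (g z) = z" by (simp add: proj_def g_def prod_eq_iff)
    moreover have "g z \<in> W" using d(2)[of z] z by (simp add: dist_commute)
    ultimately show ?thesis by (metis imageI)
  qed
  then show "\<exists>e>0. ball w e \<inter> Ann \<subseteq> proj ` W" using d(1) by blast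
qed

lemma Ann_subset_range_proj: "z \<in> Ann \<Longrightarrow> \<exists>p. proj p = z"
proof -
  assume "z \<in> Ann"
  then have "norm (fst z) = 1" by (auto simp: Ann_def)
  then have "fst z = cis (Arg (fst z))"
    using cis_Arg[of "fst z"] by (metis norm_zero sgn_div_norm zero_neq_one inverse_1 scaleR_one)
  then have "proj (Arg (fst z) / (2 * pi), snd z) = z" by (simp add: proj_def prod_eq_iff)
  then show ?thesis by blast
qed

lemma lift_Tpow: "Tpow n p \<in> lift A \<longleftrightarrow> p \<in> lift A"
  by (simp add: lift_def)

text \<open>Preimages under a continuous open map commute with closure.\<close>

lemma lift_closure:
  assumes "U \<subseteq> Ann"
  shows "lift (closure U) = closure (lift U)"
proof (intro equalityI subsetI)
  fix p assume p: "p \<in> lift (closure U)"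
  show "p \<in> closure (lift U)" unfolding closure_iff_nhds_not_empty
  proof (intro allI impI)
    fix S W assume W: "W \<subseteq> S" "open W" "p \<in> W"
    obtain Z where Z: "open Z" "proj ` W = Ann \<inter> Z" using proj_open_map[OF W(2)] unfolding openin_open by blast
    have "proj p \<in> closure U" using p by (simp add: lift_def)
    moreover have "proj p \<in> Z" using Z(2) W(3) by blast
    ultimately have "Z \<inter> U \<noteq> {}" using Z(1) open_Int_closure_eq_empty by blast
    then obtain u where "u \<in> Z" "u \<in> U" by blast
    then have "u \<in> proj ` W" using Z(2) assms by blast
    then obtain q where "q \<in> W" "proj q = u" by blast
    then have "q \<in> lift U" "q \<in> S" using \<open>u \<in> U\<close> W(1) by (auto simp: lift_def)
    then show "lift U \<inter> S \<noteq> {}" by blast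
  qed
next
  have "closed (lift (closure U))"
    unfolding lift_def by (rule closed_vimage[OF closed_closure continuous_on_proj])
  moreover have "lift U \<subseteq> lift (closure U)" using closure_subset unfolding lift_def by blast
  ultimately show "p \<in> lift (closure U)" if "p \<in> closure (lift U)" for p
    using closure_minimal that by blast
qed

lemma compactly_generated_iff:
  "compactly_generated A \<longleftrightarrow> (\<exists>G. compact G \<and> connected G \<and> lift A = translates UNIV G)"
proof
  assume "\<exists>G. compact G \<and> connected G \<and> lift A = translates UNIV G"
  then obtain G where G: "compact G" "connected G" "lift A = translates UNIV G" by blast
  have "Tpow 0 ` G \<subseteq> translates UNIV G" unfolding translates_def by blast
  then show "compactly_generated A" using G unfolding compactly_generated_def translates_def by auto
qed (auto simp: compactly_generated_def translates_def)

text \<open>The invariant connected set \<open>H\<close>, later a half-plane, ties all sheets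
  together. The component \<open>Q\<close> containing it is invariant, so \<open>Q\<close> and the
  rest of the lift have disjoint open images covering the connected set \<open>U\<close>.\<close>

lemma connected_lift:
  assumes U: "openin (top_of_set Ann) U" "connected U"
    and H: "connected H" "H \<noteq> {}" "H \<subseteq> lift U" "\<And>n. Tpow n ` H = H"
  shows "connected (lift U)" and "open (lift U)"
proof -
  obtain Z where Z: "open Z" "U = Ann \<inter> Z" using U(1) unfolding openin_open by blast
  have "lift U = proj -` Z" using Z(2) proj_in_Ann by (auto simp: lift_def)
  then show op: "open (lift U)" using open_vimage[OF Z(1) continuous_on_proj] by simp
  obtain h where h: "h \<in> H" using H(2) by blast
  define Q where "Q = connected_component_set (lift U) h"
  have HQ: "H \<subseteq> Q" unfolding Q_def using h H by (intro connected_component_maximal)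
  have Qsub: "Q \<subseteq> lift U" unfolding Q_def by (rule connected_component_subset)
  have conQ: "connected Q" unfolding Q_def by (rule connected_connected_component)
  have invQ: "Tpow n q \<in> Q" if q: "q \<in> Q" for n q
  proof -
    have "Tpow n ` Q \<subseteq> Q" unfolding Q_def
    proof (rule connected_component_maximal)
      show "h \<in> Tpow n ` connected_component_set (lift U) h"
        using h H(4)[of n] HQ unfolding Q_def by blast
      show "connected (Tpow n ` connected_component_set (lift U) h)"
        by (intro connected_Tpow_image connected_connected_component)
      show "Tpow n ` connected_component_set (lift U) h \<subseteq> lift U"
        using Qsub lift_Tpow unfolding Q_def by blast
    qed
    then show ?thesis using q by blast
  qed
  have opQ: "open Q" unfolding Q_def using op by (rule open_connected_component)
  have "closedin (top_of_set (lift U)) Q" unfolding Q_def by (rule closedin_connected_component)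
  then have "openin (top_of_set (lift U)) (lift U - Q)" by (simp add: openin_diff)
  then have opR: "open (lift U - Q)" using op openin_open_trans by blast
  obtain A where A: "open A" "proj ` Q = Ann \<inter> A" using proj_open_map[OF opQ] unfolding openin_open by blast
  obtain B where B: "open B" "proj ` (lift U - Q) = Ann \<inter> B" using proj_open_map[OF opR] unfolding openin_open by blast
  have UA: "U \<subseteq> Ann" using Z(2) by blast
  have "A \<inter> U = {} \<or> B \<inter> U = {}"
  proof (rule connectedD[OF U(2) A(1) B(1)])
    show "A \<inter> B \<inter> U = {}"
    proof (rule equals0I)
      fix u assume "u \<in> A \<inter> B \<inter> U"
      then have "u \<in> proj ` Q" "u \<in> proj ` (lift U - Q)" using A(2) B(2) UA by blast+
      then obtain a b where ab: "a \<in> Q" "b \<in> lift U - Q" "proj a = proj b" by (metis imageE)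
      then obtain n where "b = Tpow n a" using proj_eq_imp_Tpow by blast
      then show False using invQ ab by blast
    qed
    show "U \<subseteq> A \<union> B"
    proof
      fix u assume u: "u \<in> U"
      then obtain p where p: "proj p = u" using UA Ann_subset_range_proj by blast
      then have "p \<in> lift U" using u by (simp add: lift_def)
      then have "u \<in> proj ` Q \<or> u \<in> proj ` (lift U - Q)" using p by blast
      then show "u \<in> A \<union> B" using A(2) B(2) by blast
    qed
  qed
  moreover have "proj h \<in> A \<inter> U" using h HQ H(3) A(2) by (auto simp: lift_def)
  ultimately have "B \<inter> U = {}" by blast
  moreover have "proj ` (lift U - Q) \<subseteq> B \<inter> U" using B(2) unfolding lift_def by blast
  ultimately have "lift U - Q = {}" by blast
  then have "lift U = Q" using Qsub by blast
  then show "connected (lift U)" using conQ by simp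
qed

text \<open>Passes from the annulus to the setting of the locale, with the upper domain as
  \<open>P\<close>.\<close>

lemma essential_annular_continuum_lift:
  assumes A: "essential_annular_continuum A" and "thin A"
  obtains M where "thin_annular_lift (lift A) (lift (Uplus A)) (lift (Uminus A)) M 1"
    "lift (circ_part A) = closure (lift (Uplus A)) \<inter> closure (lift (Uminus A))"
proof -
  obtain U V where sub: "A \<subseteq> Ann" and cA: "compact A" "connected A" "A \<noteq> {}"
    and UV: "components (Ann - A) = {U, V}" "U \<noteq> V" "\<not> bdd_above_set U" "\<not> bdd_below_set V"
    using A unfolding essential_annular_continuum_def continuum_def by blast
  have "bounded (snd ` A)" using cA(1) compact_imp_bounded bounded_snd by blast
  then obtain M where M: "\<And>a. a \<in> A \<Longrightarrow> \<bar>snd a\<bar> \<le> M" unfolding bounded_iff by auto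
  let ?hi = "sphere (0::complex) 1 \<times> {M<..}" and ?lo = "sphere (0::complex) 1 \<times> {..<-M}"
  have consph: "connected (sphere (0::complex) 1)" by (rule connected_sphere) simp
  have conn: "connected ?hi" "connected ?lo" using consph by (auto intro: connected_Times)
  have hiA: "?hi \<subseteq> Ann - A" "?lo \<subseteq> Ann - A" using M by (fastforce simp: Ann_def)+
  have compU: "U \<in> components (Ann - A)" "V \<in> components (Ann - A)" using UV by auto
  have subU: "U \<subseteq> Ann - A" "V \<subseteq> Ann - A" using compU in_components_subset by blast+
  have hiU: "?hi \<subseteq> U"
  proof -
    obtain z where "z \<in> U" "snd z > M"
      using UV(3) unfolding bdd_above_set_def by (metis bdd_aboveI imageE linorder_not_less)
    then have "z \<in> U" "z \<in> ?hi" using subU by (auto simp: Ann_def)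
    then show ?thesis using components_maximal[OF compU(1) conn(1) hiA(1)] by blast
  qed
  have loV: "?lo \<subseteq> V"
  proof -
    obtain z where "z \<in> V" "snd z < - M"
      using UV(4) unfolding bdd_below_set_def by (metis bdd_belowI imageE linorder_not_less)
    then have "z \<in> V" "z \<in> ?lo" using subU by (auto simp: Ann_def)
    then show ?thesis using components_maximal[OF compU(2) conn(2) hiA(2)] by blast
  qed
  have disj: "U \<inter> V = {}" using components_nonoverlap[OF compU] UV(2) by blast
  have cover: "Ann - A = U \<union> V" using Union_components[of "Ann - A"] UV(1) by simp
  \<comment> \<open>\<open>U\<close> contains everything above \<open>M\<close>, so \<open>V\<close>
    is bounded above and only \<open>U\<close> contributes to \<open>Uplus A\<close>.\<close>
  have "bdd_above_set V"
  proof -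
    have "snd z \<le> M" if "z \<in> V" for z
    proof (rule ccontr)
      assume "\<not> snd z \<le> M"
      then have "z \<in> ?hi" using that subU by (auto simp: Ann_def)
      then show False using hiU disj that by blast
    qed
    then show ?thesis unfolding bdd_above_set_def bdd_above_def by blast
  qed
  then have Up: "Uplus A = U" unfolding Uplus_def UV(1) using UV(3) by blast
  have "bdd_below_set U"
  proof -
    have "- M \<le> snd z" if "z \<in> U" for z
    proof (rule ccontr)
      assume "\<not> - M \<le> snd z"
      then have "z \<in> ?lo" using that subU by (auto simp: Ann_def)
      then show False using loV disj that by blast
    qed
    then show ?thesis unfolding bdd_below_set_def bdd_below_def by blast
  qed
  then have Um: "Uminus A = V" unfolding Uminus_def UV(1) using UV(4) by blast
  have opA: "openin (top_of_set Ann) (Ann - A)"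
    using cA(1) compact_imp_closed by (metis Diff_eq open_Compl openin_open_Int)
  have clUV: "closedin (top_of_set (Ann - A)) U" "closedin (top_of_set (Ann - A)) V"
    using compU closedin_component by blast+
  \<comment> \<open>With only two components, each is the complement of the other and therefore
    relatively open.\<close>
  have "U = (Ann - A) - V" "V = (Ann - A) - U" using cover disj by blast+
  then have "openin (top_of_set (Ann - A)) U" "openin (top_of_set (Ann - A)) V"
    using clUV by (metis openin_diff openin_subtopology_self)+
  then have opU: "openin (top_of_set Ann) U" "openin (top_of_set Ann) V"
    using opA openin_trans by blast+
  have cu: "connected U" "connected V" using compU in_components_connected by blast+
  let ?Hi = "UNIV \<times> {M<..} :: (real \<times> real) set" and ?Lo = "UNIV \<times> {..<-M} :: (real \<times> real) set"
  have projsphere: "fst (proj p) \<in> sphere 0 1" for p by (simp add: proj_def)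
  have Hi: "?Hi \<subseteq> lift U" "?Lo \<subseteq> lift V"
  proof -
    show "?Hi \<subseteq> lift U"
    proof
      fix p :: "real \<times> real" assume "p \<in> ?Hi"
      then have "proj p \<in> ?hi" using projsphere[of p] by (simp add: mem_Times_iff)
      then show "p \<in> lift U" using hiU by (auto simp: lift_def)
    qed
    show "?Lo \<subseteq> lift V"
    proof
      fix p :: "real \<times> real" assume "p \<in> ?Lo"
      then have "proj p \<in> ?lo" using projsphere[of p] by (simp add: mem_Times_iff)
      then show "p \<in> lift V" using loV by (auto simp: lift_def)
    qed
  qed
  have inv: "Tpow n ` (UNIV \<times> I) = UNIV \<times> I" for n and I :: "real set"
    by (rule set_eqI) (simp add: Tpow_image_iff mem_Times_iff)
  have cHi: "connected ?Hi" "connected ?Lo" by (auto intro: connected_Times)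
  have "(0, M + 1) \<in> ?Hi" "(0, - M - 1) \<in> ?Lo" by auto
  then have neHi: "?Hi \<noteq> {}" "?Lo \<noteq> {}" by blast+
  have PU: "connected (lift U)" "open (lift U)"
    using connected_lift[OF opU(1) cu(1) cHi(1) neHi(1) Hi(1) inv] by blast+
  have PV: "connected (lift V)" "open (lift V)"
    using connected_lift[OF opU(2) cu(2) cHi(2) neHi(2) Hi(2) inv] by blast+
  have clX: "closed (lift A)" unfolding lift_def
    by (rule closed_vimage[OF compact_imp_closed[OF cA(1)] continuous_on_proj])
  have compl: "- lift A = lift U \<union> lift V"
    using cover subU proj_in_Ann unfolding lift_def by blast
  have "interior (lift A) = {}"
  proof (rule ccontr)
    assume "interior (lift A) \<noteq> {}"
    then have "proj ` interior (lift A) \<noteq> {}" by blast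
    moreover have "openin (top_of_set Ann) (proj ` interior (lift A))" by (rule proj_open_map) simp
    moreover have "proj ` interior (lift A) \<subseteq> A" using interior_subset unfolding lift_def by blast
    ultimately show False using \<open>thin A\<close> unfolding thin_def by blast
  qed
  then have dense: "closure (lift U \<union> lift V) = UNIV"
    unfolding compl[symmetric] by (simp add: closure_complement)
  have "thin_annular_lift (lift A) (lift U) (lift V) M 1"
  proof
    show "lift A \<subseteq> UNIV \<times> {-M..M}"
    proof
      fix p assume "p \<in> lift A"
      then have "\<bar>snd p\<bar> \<le> M" using M[of "proj p"] by (simp add: lift_def)
      then show "p \<in> UNIV \<times> {-M..M}" by (auto simp: mem_Times_iff)
    qed
    show "lift U \<inter> lift V = {}" using disj unfolding lift_def by blast
    show "p \<in> lift U" if "1 * snd p > M" for p using Hi(1) that by (auto simp: mem_Times_iff)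
    show "p \<in> lift V" if "1 * snd p < - M" for p using Hi(2) that by (auto simp: mem_Times_iff)
    fix F F' :: "(real \<times> real) set"
    assume F: "closed F" "closed F'" "F \<inter> F' = {}" "F \<union> F' = lift A"
      "\<And>n p. p \<in> F \<Longrightarrow> Tpow n p \<in> F" "\<And>n p. p \<in> F' \<Longrightarrow> Tpow n p \<in> F'"
    \<comment> \<open>An invariant splitting of the lift descends to \<open>A\<close>: each fibre
      over \<open>A\<close> lies entirely in \<open>F\<close> or in \<open>F'\<close>, so the open
      images of the complements split \<open>A\<close>.\<close>
    obtain Z where Z: "open Z" "proj ` (- F) = Ann \<inter> Z"
      using proj_open_map[of "- F"] F(1) unfolding openin_open by blast
    obtain Z' where Z': "open Z'" "proj ` (- F') = Ann \<inter> Z'"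
      using proj_open_map[of "- F'"] F(2) unfolding openin_open by blast
    have in_F: "q \<in> F" if "p \<in> F" "proj p = proj q" for p q
      using proj_eq_imp_Tpow[OF that(2)] F(5) that(1) by metis
    have in_F': "q \<in> F'" if "p \<in> F'" "proj p = proj q" for p q
      using proj_eq_imp_Tpow[OF that(2)] F(6) that(1) by metis
    have "Z \<inter> A = {} \<or> Z' \<inter> A = {}"
    proof (rule connectedD[OF cA(2) Z(1) Z'(1)])
      show "Z \<inter> Z' \<inter> A = {}"
      proof (rule equals0I)
        fix a assume a: "a \<in> Z \<inter> Z' \<inter> A"
        then have "a \<in> proj ` (- F)" "a \<in> proj ` (- F')" using Z(2) Z'(2) sub by blast+
        then obtain p q where pq: "p \<notin> F" "q \<notin> F'" "a = proj p" "a = proj q" by blast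
        then have "p \<in> lift A" "q \<in> lift A" using a by (auto simp: lift_def)
        then have "p \<in> F'" using pq F(4) by blast
        then have "q \<in> F'" using in_F' pq by metis
        then show False using pq by blast
      qed
      show "A \<subseteq> Z \<union> Z'"
      proof
        fix a assume "a \<in> A"
        then obtain p where "proj p = a" using sub Ann_subset_range_proj by blast
        then have "a \<in> proj ` (- F) \<or> a \<in> proj ` (- F')" using F(3) by blast
        then show "a \<in> Z \<union> Z'" using Z(2) Z'(2) by blast
      qed
    qed
    then show "F = {} \<or> F' = {}"
    proof
      assume e: "Z \<inter> A = {}"
      have False if "p \<in> F'" for p
      proof -
        have "p \<notin> F" "proj p \<in> A" using that F(3,4) by (auto simp: lift_def)
        then show False using e Z(2) sub by blast
      qed
      then show ?thesis by blast
    next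
      assume e: "Z' \<inter> A = {}"
      have False if "p \<in> F" for p
      proof -
        have "p \<notin> F'" "proj p \<in> A" using that F(3,4) by (auto simp: lift_def)
        then show False using e Z'(2) sub by blast
      qed
      then show ?thesis by blast
    qed
  qed (use PU PV clX compl dense lift_Tpow in auto)
  moreover have "lift (circ_part A) = closure (lift U) \<inter> closure (lift V)"
  proof -
    have "U \<subseteq> Ann" "V \<subseteq> Ann" using subU by blast+
    moreover have "lift (circ_part A) = lift (closure U) \<inter> lift (closure V)"
      unfolding circ_part_def Up Um lift_def by blast
    ultimately show ?thesis using lift_closure by metis
  qed
  ultimately show ?thesis using that unfolding Up Um by blast
qed

theorem mainTheorem3:
  fixes A :: "(complex \<times> real) set"
  assumes "essential_annular_continuum A" and "thin A"
  shows "(\<not> compactly_generated A \<longrightarrow>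
            (\<not> compactly_generated (circ_part A) \<or>
             (compactly_generated (circ_part A) \<and> has_infinite_spike A)))
       \<and> (compactly_generated A \<longrightarrow> compactly_generated (circ_part A))"
proof -
  let ?C = "closure (lift (Uplus A)) \<inter> closure (lift (Uminus A))"
  obtain M where M: "thin_annular_lift (lift A) (lift (Uplus A)) (lift (Uminus A)) M 1"
    and C: "lift (circ_part A) = ?C"
    using essential_annular_continuum_lift[OF assms] by blast
  interpret thin_annular_lift "lift A" "lift (Uplus A)" "lift (Uminus A)" M 1 by (rule M)
  \<comment> \<open>The contrapositive of (1): with \<open>C\<close> generated and every spike of
    finite width, \<open>A\<close> is generated.\<close>
  have "compactly_generated A" if gen: "compactly_generated (circ_part A)" and fin: "\<not> has_infinite_spike A"
  proof -
    obtain G where G: "compact G" "connected G" "?C = translates UNIV G"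
      using gen unfolding compactly_generated_iff C by blast
    have "\<exists>r. tied (lift A) ?C r x" if x: "x \<in> lift A - ?C" for x
    proof -
      let ?S = "connected_component_set (lift A - ?C) x"
      have "?S \<in> spikes A" unfolding spikes_def C using x by (rule componentsI)
      then have "hwidth ?S \<noteq> \<infinity>" using fin unfolding has_infinite_spike_def by blast
      \<comment> \<open>The width is a supremum over ordered pairs, so a finite bound
        \<open>r\<close> controls differences in both directions.\<close>
      then obtain r where r: "hwidth ?S \<le> ereal r"
        by (cases "hwidth ?S") auto
      have le: "fst p - fst q \<le> r" if "p \<in> ?S" "q \<in> ?S" for p q
      proof -
        have "(p, q) \<in> ?S \<times> ?S" using that by blast
        then have "ereal (fst (fst (p, q)) - fst (snd (p, q))) \<le> hwidth ?S"
          unfolding hwidth_def by (rule SUP_upper)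
        then have "ereal (fst p - fst q) \<le> ereal r" using r by (simp only: fst_conv snd_conv)
        then show ?thesis by simp
      qed
      have xS: "x \<in> ?S" using x by simp
      have "tied (lift A) ?C (r + 1) x"
      proof (rule tied_if_spike_bounded[OF x])
        show "0 \<le> r" using le[OF xS xS] by simp
        fix S y assume S: "connected S" "x \<in> S" "S \<subseteq> lift A - ?C" "y \<in> S"
        then have "y \<in> ?S" using connected_component_maximal[OF S(2,1,3)] by blast
        then show "\<bar>fst y - fst x\<bar> \<le> r" using le[of y x] le[of x y] xS by auto
      qed
      then show ?thesis by blast
    qed
    then obtain H where "compact H" "connected H" "lift A = translates UNIV H"
      using generated_X[OF _ G] by blast
    then show ?thesis unfolding compactly_generated_iff by blast
  qed
  moreover have "compactly_generated (circ_part A)" if gen: "compactly_generated A"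
  proof -
    obtain G where "compact G" "connected G" "lift A = translates UNIV G"
      using gen unfolding compactly_generated_iff by blast
    then obtain H where "compact H" "connected H" "?C = translates UNIV H"
      using generated_C by blast
    then show ?thesis unfolding compactly_generated_iff C by blast
  qed
  ultimately show ?thesis by blast
qed

end
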